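(* The following inequality is not true: $$C\,|||(\tau,v)|||^2\le\|\nabla_hv+\tau\|_0^2+\|\nabla\cdot\tau\|_0^2\qquad\text{for all }(\tau,v)\in H(\mathrm{div};\Omega)\times W_D^{1+cr};$$ that is, there is no constant $C>0$ for which this inequality holds for all $(\tau,v)\in H(\mathrm{div};\Omega)\times W_D^{1+cr}$.
   Context: $d\in\{2,3\}$; $\Omega\subset\mathbb R^d$ is bounded, open, connected with Lipschitz boundary; $\partial\Omega=\overline{\Gamma_D}\cup\overline{\Gamma_N}$ with $\Gamma_D,\Gamma_N$ disjoint open subsets of $\partial\Omega$, $\Gamma_D$ connected and of positive measure, and $\Gamma_N$ not empty. $\|\cdot\|_0$ is the $L^2(\Omega)$ norm. $H(\mathrm{div};\Omega)=\{\tau\in L^2(\Omega)^d:\nabla\cdot\tau\in L^2(\Omega)\}$ and $H^1_D(\Omega)=\{v\in H^1(\Omega):v=0\text{ on }\Gamma_D\}$. $\mathcal T$ is a regular (shape-regular) triangulation of $\Omega$ by simplices, each of whose boundary faces (edges if $d=2$) belongs to $\Gamma_D$ or to $\Gamma_N$; $\mathcal E_{int}$, $\mathcal E_D$ are the sets of its faces (edges if $d=2$) that are interior, respectively belong to $\Gamma_D$. $[\![v]\!]_F$ is the difference of the two traces of $v$ on $F\in\mathcal E_{int}$. $\nabla_h$ is the elementwise gradient, $(\nabla_h v)|_K=\nabla(v|_K)$ for all $K\in\mathcal T$. $V^{cr}_D=\{v\in L^2(\Omega): v|_K\in P_1(K)\ \forall K\in\mathcal T,\ \int_F[\![v]\!]_F\,ds=0\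 \forall F\in\mathcal E_{int},\ \int_Fv\,ds=0\ \forall F\in\mathcal E_D\}$ is the Crouzeix–Raviart space, where $P_1(K)$ is the space of polynomials of degree at most $1$ on $K$, and $W_D^{1+cr}=H_D^1(\Omega)+V_D^{cr}=\{v_1+v_2:v_1\in H^1_D(\Omega),\ v_2\in V^{cr}_D\}$. The norm is $|||(\tau,v)|||^2=\|\nabla_hv\|_0^2+\|\tau\|_0^2+\|\nabla\cdot\tau\|_0^2$. The right-hand side of the inequality is the two-field potential-flux div least-squares functional with zero data for the equation $-\nabla\cdot(A\nabla u)+b\cdot\nabla u+cu=f$ in the simple case $A=I$, $b=0$, $c=0$. *)

theory Defs
  imports "HOL-Analysis.Analysis"
begin

section \<open>Square-integrable functions and weak derivatives\<close>

text \<open>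
  Elements of the function spaces below are represented by functions on the whole space; only
  their values almost everywhere on the domain matter, and all notions are invariant under
  modification on null sets.
\<close>

definition L2 :: "'a::euclidean_space set \<Rightarrow> ('a \<Rightarrow> 'b::euclidean_space) set" where
  "L2 \<Omega> = {f. f \<in> borel_measurable (lebesgue_on \<Omega>) \<and>
               integrable (lebesgue_on \<Omega>) (\<lambda>x. (norm (f x))\<^sup>2)}"

definition L2_norm :: "'a::euclidean_space set \<Rightarrow> ('a \<Rightarrow> 'b::euclidean_space) \<Rightarrow> real" where
  "L2_norm \<Omega> f = sqrt (LINT x|lebesgue_on \<Omega>. (norm (f x))\<^sup>2)"

definition grad :: "('a::euclidean_space \<Rightarrow> real) \<Rightarrow> 'a \<Rightarrow> 'a" where
  "grad f x = (\<Sum>i\<in>Basis. frechet_derivative f (at x) i *\<^sub>R i)"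

text \<open>\<^term>\<open>k\<close> times continuously differentiable on the whole space\<close>

primrec Ck :: "nat \<Rightarrow> ('a::euclidean_space \<Rightarrow> real) \<Rightarrow> bool" where
  "Ck 0 f \<longleftrightarrow> continuous_on UNIV f"
| "Ck (Suc k) f \<longleftrightarrow> f differentiable_on UNIV \<and>
                   (\<forall>i\<in>Basis. Ck k (\<lambda>x. frechet_derivative f (at x) i))"

definition Cinf :: "('a::euclidean_space \<Rightarrow> real) set" where
  "Cinf = {f. \<forall>k. Ck k f}"

definition test_functions :: "'a::euclidean_space set \<Rightarrow> ('a \<Rightarrow> real) set" where
  "test_functions \<Omega> =
     {\<phi> \<in> Cinf. compact (closure {x. \<phi> x \<noteq> 0}) \<and> closure {x. \<phi> x \<noteq> 0} \<subseteq> \<Omega>}"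

text \<open>
  Weak gradient and weak divergence are given as relations; the second argument of each is
  determined by the first up to null sets, and is required to be square-integrable.
\<close>

definition has_weak_grad ::
  "'a::euclidean_space set \<Rightarrow> ('a \<Rightarrow> real) \<Rightarrow> ('a \<Rightarrow> 'a) \<Rightarrow> bool" where
  "has_weak_grad \<Omega> v g \<longleftrightarrow> v \<in> L2 \<Omega> \<and> g \<in> L2 \<Omega> \<and>
     (\<forall>\<phi>\<in>test_functions \<Omega>.
        (LINT x|lebesgue_on \<Omega>. v x *\<^sub>R grad \<phi> x) = - (LINT x|lebesgue_on \<Omega>. \<phi> x *\<^sub>R g x))"

definition has_weak_div ::
  "'a::euclidean_space set \<Rightarrow> ('a \<Rightarrow> 'a) \<Rightarrow> ('a \<Rightarrow> real) \<Rightarrow> bool" where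
  "has_weak_div \<Omega> \<tau> q \<longleftrightarrow> \<tau> \<in> L2 \<Omega> \<and> q \<in> L2 \<Omega> \<and>
     (\<forall>\<phi>\<in>test_functions \<Omega>.
        (LINT x|lebesgue_on \<Omega>. \<tau> x \<bullet> grad \<phi> x) = - (LINT x|lebesgue_on \<Omega>. q x * \<phi> x))"

definition H1 :: "'a::euclidean_space set \<Rightarrow> ('a \<Rightarrow> real) set" where
  "H1 \<Omega> = {v. \<exists>g. has_weak_grad \<Omega> v g}"

definition Hdiv :: "'a::euclidean_space set \<Rightarrow> ('a \<Rightarrow> 'a) set" where
  "Hdiv \<Omega> = {\<tau>. \<exists>q. has_weak_div \<Omega> \<tau> q}"


section \<open>Lipschitz domains\<close>

text \<open>
  Near each boundary point, \<^term>\<open>\<Omega>\<close> is the part of a ball strictly above the graph of a Lipschitz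
  function in the direction \<^term>\<open>e\<close>; the function is defined on the hyperplane orthogonal to
  \<^term>\<open>e\<close>.
\<close>

definition lipschitz_boundary :: "'a::euclidean_space set \<Rightarrow> bool" where
  "lipschitz_boundary \<Omega> \<longleftrightarrow>
     (\<forall>x\<in>frontier \<Omega>. \<exists>r e h L. r > 0 \<and> norm e = 1 \<and> L-lipschitz_on {z. z \<bullet> e = 0} h \<and>
        \<Omega> \<inter> ball x r = {y \<in> ball x r. h (y - (y \<bullet> e) *\<^sub>R e) < y \<bullet> e})"


section \<open>Triangulations and integration over faces\<close>

definition simplicial_mesh :: "'a::euclidean_space set \<Rightarrow> 'a set set \<Rightarrow> bool" where
  "simplicial_mesh \<Omega> T \<longleftrightarrow>
     triangulation T \<and> (\<forall>K\<in>T. int DIM('a) simplex K) \<and> \<Union>T = closure \<Omega>"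

definition shape_regular :: "real \<Rightarrow> 'a::euclidean_space set set \<Rightarrow> bool" where
  "shape_regular \<kappa> T \<longleftrightarrow> (\<forall>K\<in>T. \<exists>x r. r > 0 \<and> cball x r \<subseteq> K \<and> diameter K \<le> \<kappa> * r)"

definition interior_faces :: "'a::euclidean_space set set \<Rightarrow> 'a set set" where
  "interior_faces T = {F. \<exists>K\<in>T. \<exists>K'\<in>T. K \<noteq> K' \<and> F facet_of K \<and> F facet_of K'}"

definition boundary_faces :: "'a::euclidean_space set \<Rightarrow> 'a set set \<Rightarrow> 'a set set" where
  "boundary_faces \<Omega> T = {F. (\<exists>K\<in>T. F facet_of K) \<and> F \<subseteq> frontier \<Omega>}"

text \<open>
  Faces are closed and \<^term>\<open>\<Gamma>\<close> is relatively open in the boundary, so a face belongs to \<^term>\<open>\<Gamma>\<close>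
  if it is contained in the closure of \<^term>\<open>\<Gamma>\<close>.
\<close>

definition faces_on ::
  "'a::euclidean_space set \<Rightarrow> 'a set set \<Rightarrow> 'a set \<Rightarrow> 'a set set" where
  "faces_on \<Omega> T \<Gamma> = {F \<in> boundary_faces \<Omega> T. F \<subseteq> closure \<Gamma>}"

definition unit_normal :: "'a::euclidean_space set \<Rightarrow> 'a" where
  "unit_normal F = (SOME n. norm n = 1 \<and> (\<forall>x\<in>F. \<forall>y\<in>F. n \<bullet> (x - y) = 0))"

text \<open>
  The surface measure on a flat face \<^term>\<open>F\<close> of codimension one, i.e. the Lebesgue measure of the
  hyperplane spanned by \<^term>\<open>F\<close>, restricted to \<^term>\<open>F\<close>. It is obtained by projecting the Lebesgue
  measure on the right prism of height 1 over \<^term>\<open>F\<close> orthogonally onto that hyperplane.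
\<close>

definition face_measure :: "'a::euclidean_space set \<Rightarrow> 'a measure" where
  "face_measure F =
     distr (lebesgue_on {x + t *\<^sub>R unit_normal F | x t. x \<in> F \<and> t \<in> {0..1}}) borel
           (closest_point (affine hull F))"

text \<open>
  The boundary of a triangulated domain is the union of its boundary faces, which overlap only
  in sets of surface measure zero.
\<close>

definition boundary_area ::
  "'a::euclidean_space set \<Rightarrow> 'a set set \<Rightarrow> 'a set \<Rightarrow> ennreal" where
  "boundary_area \<Omega> T A = (\<Sum>F\<in>boundary_faces \<Omega> T. emeasure (face_measure F) A)"


section \<open>Traces and the space of functions vanishing on the Dirichlet boundary\<close>

text \<open>
  The trace operator is the continuous extension to the Sobolev space of the restriction of
  functions smooth up to the boundary: \<^term>\<open>g\<close> is the trace of \<^term>\<open>v\<close> if smooth functions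
  converge to \<^term>\<open>v\<close> in the Sobolev norm and their boundary values converge to \<^term>\<open>g\<close> in the
  space of square-integrable functions on the boundary.
\<close>

definition has_trace ::
  "'a::euclidean_space set \<Rightarrow> 'a set set \<Rightarrow> ('a \<Rightarrow> real) \<Rightarrow> ('a \<Rightarrow> real) \<Rightarrow> bool" where
  "has_trace \<Omega> T v g \<longleftrightarrow> g \<in> borel_measurable borel \<and>
     (\<forall>F\<in>boundary_faces \<Omega> T. integrable (face_measure F) (\<lambda>x. (g x)\<^sup>2)) \<and>
     (\<exists>w \<phi>. has_weak_grad \<Omega> v w \<and> (\<forall>n::nat. \<phi> n \<in> Cinf) \<and>
        (\<lambda>n. L2_norm \<Omega> (\<lambda>x. \<phi> n x - v x)) \<longlonglongrightarrow> 0 \<and>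
        (\<lambda>n. L2_norm \<Omega> (\<lambda>x. grad (\<phi> n) x - w x)) \<longlonglongrightarrow> 0 \<and>
        (\<forall>F\<in>boundary_faces \<Omega> T. (\<lambda>n. LINT x|face_measure F. (\<phi> n x - g x)\<^sup>2) \<longlonglongrightarrow> 0))"

definition H1D ::
  "'a::euclidean_space set \<Rightarrow> 'a set set \<Rightarrow> 'a set \<Rightarrow> ('a \<Rightarrow> real) set" where
  "H1D \<Omega> T \<Gamma>\<^sub>D = {v \<in> H1 \<Omega>. \<exists>g. has_trace \<Omega> T v g \<and>
     (\<forall>F\<in>boundary_faces \<Omega> T. AE x in face_measure F. x \<in> \<Gamma>\<^sub>D \<longrightarrow> g x = 0)}"


section \<open>The Crouzeix--Raviart space and the elementwise gradient\<close>

text \<open>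
  On \<^term>\<open>K\<close> the function is the affine function with gradient \<^term>\<open>a K\<close> and constant term
  \<^term>\<open>b K\<close>, whose restriction to a face of \<^term>\<open>K\<close> is its trace from \<^term>\<open>K\<close>.
\<close>

definition CR_space ::
  "'a::euclidean_space set \<Rightarrow> 'a set set \<Rightarrow> 'a set \<Rightarrow> ('a \<Rightarrow> real) set" where
  "CR_space \<Omega> T \<Gamma>\<^sub>D = {v \<in> L2 \<Omega>. \<exists>a b.
     (\<forall>K\<in>T. AE x in lebesgue_on K. x \<in> \<Omega> \<longrightarrow> v x = a K \<bullet> x + b K) \<and>
     (\<forall>F\<in>interior_faces T. \<forall>K\<in>T. \<forall>K'\<in>T. K \<noteq> K' \<and> F facet_of K \<and> F facet_of K' \<longrightarrow>
        (LINT x|face_measure F. (a K \<bullet> x + b K) - (a K' \<bullet> x + b K')) = 0) \<and>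
     (\<forall>F\<in>faces_on \<Omega> T \<Gamma>\<^sub>D. \<forall>K\<in>T. F facet_of K \<longrightarrow>
        (LINT x|face_measure F. a K \<bullet> x + b K) = 0)}"

definition W_space ::
  "'a::euclidean_space set \<Rightarrow> 'a set set \<Rightarrow> 'a set \<Rightarrow> ('a \<Rightarrow> real) set" where
  "W_space \<Omega> T \<Gamma>\<^sub>D = {\<lambda>x. v\<^sub>1 x + v\<^sub>2 x | v\<^sub>1 v\<^sub>2. v\<^sub>1 \<in> H1D \<Omega> T \<Gamma>\<^sub>D \<and> v\<^sub>2 \<in> CR_space \<Omega> T \<Gamma>\<^sub>D}"

definition has_broken_grad ::
  "'a::euclidean_space set \<Rightarrow> 'a set set \<Rightarrow> ('a \<Rightarrow> real) \<Rightarrow> ('a \<Rightarrow> 'a) \<Rightarrow> bool" where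
  "has_broken_grad \<Omega> T v g \<longleftrightarrow> g \<in> L2 \<Omega> \<and> (\<forall>K\<in>T. has_weak_grad (interior K) v g)"

end

theory Submission
  imports Defs
begin

text \<open>
  No boundary condition is imposed on the flux \<^term>\<open>\<tau>\<close>. On the Neumann part of the
  boundary neither the trace of \<^term>\<open>v\<close> nor the normal component of \<^term>\<open>\<tau>\<close> is
  prescribed, so the homogeneous first-order system \<open>\<nabla>v + \<tau> = 0\<close>, \<open>div \<tau> = 0\<close> has
  nonzero solutions: any nonconstant harmonic \<^term>\<open>v\<close> that vanishes on \<^term>\<open>\<Gamma>\<^sub>D\<close>, with
  \<open>\<tau> = - \<nabla>v\<close>. For such a pair the functional is zero and the norm is not. The failure thus
  occurs already for conforming functions, and it remains to produce enough of a harmonic function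
  to refute every constant.

  Take a smooth bump \<^term>\<open>u\<close> around a point of \<^term>\<open>\<Gamma>\<^sub>N\<close> that vanishes on
  \<^term>\<open>\<Gamma>\<^sub>D\<close>, and let \<^term>\<open>p\<close> be the orthogonal projection of its gradient onto the
  \<open>L\<^sup>2\<close>-closure of the gradients of test functions (lemma \<open>L2_projection\<close>). Orthogonality to
  the gradients of all test functions says precisely that \<open>\<tau> = p - \<nabla>u\<close> has weak divergence
  zero; this is Dirichlet's principle for the harmonic function with the boundary values of
  \<^term>\<open>u\<close>. If \<open>\<nabla>\<phi>\<^sub>n\<close> tends to \<^term>\<open>p\<close>, then
  the smooth functions \<open>v\<^sub>n = u - \<phi>\<^sub>n\<close> satisfy \<open>\<nabla>v\<^sub>n + \<tau> \<rightarrow> 0\<close>, while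
  \<^term>\<open>\<tau>\<close> is fixed, and they vanish on \<^term>\<open>\<Gamma>\<^sub>D\<close>. Hence an inequality with a constant
  \<open>C > 0\<close> would force \<open>\<tau> = 0\<close>.

  To see that \<open>\<tau> \<noteq> 0\<close>, test it against a constant field \<^term>\<open>e\<close>. Gradients of test functions
  integrate to zero over \<^term>\<open>\<Omega>\<close> (lemma \<open>integral_grad_test_function\<close>), hence so does
  \<^term>\<open>p\<close>, and \<open>\<integral>\<tau> \<bullet> e = - \<integral>\<nabla>u \<bullet> e\<close>. The Lipschitz graph condition permits a choice of
  \<^term>\<open>u\<close> that is nonincreasing in the graph direction \<^term>\<open>e\<close> throughout \<^term>\<open>\<Omega>\<close> and
  strictly decreasing somewhere (lemma \<open>lipschitz_boundary_bump\<close>), so the last integral is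
  negative.
\<close>

section \<open>The Hilbert space of square-integrable functions\<close>

lemma quadratic_nonneg_imp_discriminant:
  fixes A B C :: real
  assumes "C \<ge> 0" and "\<And>t. 0 \<le> A + 2 * t * B + t\<^sup>2 * C"
  shows "B\<^sup>2 \<le> A * C"
proof (cases "C = 0")
  case True
  have "B = 0"
  proof (rule ccontr)
    assume "B \<noteq> 0"
    with assms(2)[of "- (A + 1) / (2 * B)"] True show False by (simp add: field_simps)
  qed
  then show ?thesis by (simp add: True)
next
  case False
  with assms(1) have "C > 0" by simp
  with assms(2)[of "- B / C"] show ?thesis by (simp add: field_simps power2_eq_square)
qed

lemma L2_iff:
  "f \<in> L2 \<Omega> \<longleftrightarrow> f \<in> borel_measurable (lebesgue_on \<Omega>) \<and>
     integrable (lebesgue_on \<Omega>) (\<lambda>x. (norm (f x))\<^sup>2)"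
  by (simp add: L2_def)

lemma L2_norm_square: "(L2_norm \<Omega> f)\<^sup>2 = (LINT x|lebesgue_on \<Omega>. (norm (f x))\<^sup>2)"
  by (simp add: L2_norm_def)

lemma L2_norm_nonneg: "L2_norm \<Omega> f \<ge> 0"
  by (simp add: L2_norm_def)

lemma L2_inner_integrable:
  assumes "f \<in> L2 \<Omega>" "g \<in> L2 \<Omega>"
  shows "integrable (lebesgue_on \<Omega>) (\<lambda>x. f x \<bullet> g x)"
proof (rule Bochner_Integration.integrable_bound)
  show "integrable (lebesgue_on \<Omega>) (\<lambda>x. (norm (f x))\<^sup>2 + (norm (g x))\<^sup>2)"
    using assms by (auto simp: L2_iff)
  show "(\<lambda>x. f x \<bullet> g x) \<in> borel_measurable (lebesgue_on \<Omega>)"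
    using assms by (auto simp: L2_iff)
  have "norm (f x \<bullet> g x) \<le> norm ((norm (f x))\<^sup>2 + (norm (g x))\<^sup>2)" for x
  proof -
    have "norm (f x \<bullet> g x) \<le> norm (f x) * norm (g x)" by (simp add: Cauchy_Schwarz_ineq2)
    also have "\<dots> \<le> (norm (f x))\<^sup>2 + (norm (g x))\<^sup>2"
      using sum_squares_bound[of "norm (f x)" "norm (g x)"]
        mult_nonneg_nonneg[OF norm_ge_zero[of "f x"] norm_ge_zero[of "g x"]] by linarith
    finally show ?thesis by simp
  qed
  then show "AE x in lebesgue_on \<Omega>. norm (f x \<bullet> g x) \<le> norm ((norm (f x))\<^sup>2 + (norm (g x))\<^sup>2)"
    by simp
qed

lemma L2_add_scale:
  assumes f: "f \<in> L2 \<Omega>" and g: "g \<in> L2 \<Omega>"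
  shows "(\<lambda>x. f x + t *\<^sub>R g x) \<in> L2 \<Omega>"
    and "(L2_norm \<Omega> (\<lambda>x. f x + t *\<^sub>R g x))\<^sup>2 =
      (L2_norm \<Omega> f)\<^sup>2 + 2 * t * (LINT x|lebesgue_on \<Omega>. f x \<bullet> g x) + t\<^sup>2 * (L2_norm \<Omega> g)\<^sup>2"
proof -
  have eq: "(norm (f x + t *\<^sub>R g x))\<^sup>2 =
      (norm (f x))\<^sup>2 + 2 * t * (f x \<bullet> g x) + t\<^sup>2 * (norm (g x))\<^sup>2" for x
    unfolding power2_norm_eq_inner
    by (simp add: inner_add_left inner_add_right inner_commute power2_eq_square algebra_simps)
  note int = L2_inner_integrable[OF f g]
  show "(\<lambda>x. f x + t *\<^sub>R g x) \<in> L2 \<Omega>"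
    using f g int unfolding L2_iff eq by (intro conjI) (auto)
  show "(L2_norm \<Omega> (\<lambda>x. f x + t *\<^sub>R g x))\<^sup>2 =
      (L2_norm \<Omega> f)\<^sup>2 + 2 * t * (LINT x|lebesgue_on \<Omega>. f x \<bullet> g x) + t\<^sup>2 * (L2_norm \<Omega> g)\<^sup>2"
    using f g int unfolding L2_norm_square eq L2_iff
    by (subst Bochner_Integration.integral_add; simp)+
qed

lemma L2_diff:
  assumes "f \<in> L2 \<Omega>" and "g \<in> L2 \<Omega>"
  shows "(\<lambda>x. f x - g x) \<in> L2 \<Omega>"
  using L2_add_scale(1)[OF assms, of "-1"] by simp

lemma L2_Cauchy_Schwarz:
  assumes "f \<in> L2 \<Omega>" "g \<in> L2 \<Omega>"
  shows "\<bar>LINT x|lebesgue_on \<Omega>. f x \<bullet> g x\<bar> \<le> L2_norm \<Omega> f * L2_norm \<Omega> g"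
proof -
  have "(LINT x|lebesgue_on \<Omega>. f x \<bullet> g x)\<^sup>2 \<le> (L2_norm \<Omega> f)\<^sup>2 * (L2_norm \<Omega> g)\<^sup>2"
    by (rule quadratic_nonneg_imp_discriminant)
      (simp_all add: L2_add_scale(2)[OF assms, symmetric])
  then have "\<bar>LINT x|lebesgue_on \<Omega>. f x \<bullet> g x\<bar> \<le> \<bar>L2_norm \<Omega> f * L2_norm \<Omega> g\<bar>"
    by (simp add: abs_le_square_iff power_mult_distrib)
  then show ?thesis by (simp add: L2_norm_nonneg)
qed

text \<open>
  Completeness, for rapidly converging Cauchy sequences only, since a minimising sequence can be
  chosen with any rate. The rate \<open>(1/4)^n\<close> of the squared norms makes
  \<open>\<Sum>n. 2^n * (norm (f (n+1) - f n))\<^sup>2\<close> integrable, hence finite almost everywhere; this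
  gives a pointwise limit, and Fatou's lemma turns it into a limit in norm.
\<close>

lemma L2_complete_fast:
  fixes f :: "nat \<Rightarrow> 'a::euclidean_space \<Rightarrow> 'b::euclidean_space"
  assumes f: "\<And>n. f n \<in> L2 \<Omega>"
    and fast: "\<And>m n. n \<le> m \<Longrightarrow> (L2_norm \<Omega> (\<lambda>x. f m x - f n x))\<^sup>2 \<le> (1/4)^n"
  obtains p where "p \<in> L2 \<Omega>" "(\<lambda>n. L2_norm \<Omega> (\<lambda>x. p x - f n x)) \<longlonglongrightarrow> 0"
proof -
  let ?M = "lebesgue_on \<Omega>"
  have [measurable]: "f n \<in> borel_measurable ?M" for n using f by (auto simp: L2_iff)
  have nn: "(\<integral>\<^sup>+x. ennreal ((norm (f m x - f n x))\<^sup>2) \<partial>?M) \<le> ennreal ((1/4)^n)"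
    if "n \<le> m" for m n
    using fast[OF that] L2_diff[OF f f, of m n] unfolding L2_norm_square
    by (subst nn_integral_eq_integral) (auto simp: L2_iff intro: ennreal_leI)
  define D where "D n x = (norm (f (Suc n) x - f n x))\<^sup>2" for n x
  have [measurable]: "D n \<in> borel_measurable ?M" for n unfolding D_def by measurable
  have "(\<integral>\<^sup>+x. (\<Sum>n. ennreal (2^n * D n x)) \<partial>?M) = (\<Sum>n. \<integral>\<^sup>+x. ennreal (2^n * D n x) \<partial>?M)"
    by (rule nn_integral_suminf) measurable
  also have "\<dots> \<le> (\<Sum>n. ennreal ((1/2)^n))"
  proof (intro suminf_le allI)
    fix n
    have "(\<integral>\<^sup>+x. ennreal (2^n * D n x) \<partial>?M) = ennreal (2^n) * (\<integral>\<^sup>+x. ennreal (D n x) \<partial>?M)"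
      by (subst nn_integral_cmult[symmetric]) (auto simp: ennreal_mult D_def)
    also have "\<dots> \<le> ennreal (2^n) * ennreal ((1/4)^n)"
      unfolding D_def using nn[of n "Suc n"] by (intro mult_left_mono) auto
    also have "\<dots> = ennreal ((1/2)^n)"
      by (simp add: ennreal_mult[symmetric] power_mult_distrib[symmetric])
    finally show "(\<integral>\<^sup>+x. ennreal (2^n * D n x) \<partial>?M) \<le> ennreal ((1/2)^n)" .
  qed auto
  also have "\<dots> = ennreal (\<Sum>n. (1/2)^n)"
    by (rule suminf_ennreal2) (auto intro: summable_geometric)
  finally have "(\<integral>\<^sup>+x. (\<Sum>n. ennreal (2^n * D n x)) \<partial>?M) \<noteq> \<infinity>"
    by (metis ennreal_neq_top infinity_ennreal_def top.extremum_unique)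
  then have "AE x in ?M. (\<Sum>n. ennreal (2^n * D n x)) \<noteq> \<infinity>"
    by (intro nn_integral_PInf_AE) measurable
  then have conv: "AE x in ?M. convergent (\<lambda>n. f n x)"
  proof eventually_elim
    fix x assume fin: "(\<Sum>n. ennreal (2^n * D n x)) \<noteq> \<infinity>"
    have sD: "summable (\<lambda>n. 2^n * D n x)"
      by (rule summable_suminf_not_top) (use fin in \<open>auto simp: D_def\<close>)
    have "summable (\<lambda>n. norm (f (Suc n) x - f n x))"
    proof (rule summable_comparison_test')
      show "summable (\<lambda>n. 2^n * D n x + (1/2)^n)"
        by (intro summable_add sD summable_geometric) auto
      fix n :: nat assume "n \<ge> 0"
      define a where "a = norm (f (Suc n) x - f n x)"
      \<comment> \<open>The inequality between arithmetic and geometric mean, with weights \<open>2^n\<close> and \<open>(1/2)^n\<close>.\<close>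
      have "0 \<le> (2^n * a - 1)\<^sup>2 / 2^n" by simp
      also have "(2^n * a - 1)\<^sup>2 / 2^n = 2^n * a\<^sup>2 - 2 * a + (1/2)^n"
        by (simp add: field_simps power2_eq_square power_divide)
      finally have "2 * a \<le> 2^n * a\<^sup>2 + (1/2)^n" by simp
      moreover have "a \<ge> 0" by (simp add: a_def)
      ultimately have "a \<le> 2^n * a\<^sup>2 + (1/2)^n" by linarith
      then show "norm (norm (f (Suc n) x - f n x)) \<le> 2^n * D n x + (1/2)^n"
        by (simp add: D_def a_def)
    qed
    then have "summable (\<lambda>n. f (Suc n) x - f n x)" by (rule summable_norm_cancel)
    then obtain l where "(\<lambda>n. \<Sum>i<n. f (Suc i) x - f i x) \<longlonglongrightarrow> l"
      by (auto simp: summable_def sums_def)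
    then have "(\<lambda>n. f n x - f 0 x) \<longlonglongrightarrow> l" by (simp add: sum_lessThan_telescope[of "\<lambda>n. f n x"])
    then have "(\<lambda>n. (f n x - f 0 x) + f 0 x) \<longlonglongrightarrow> l + f 0 x" by (intro tendsto_intros)
    then show "convergent (\<lambda>n. f n x)" by (auto simp: convergent_def)
  qed
  define p where "p x = lim (\<lambda>n. f n x)" for x
  have p_meas [measurable]: "p \<in> borel_measurable ?M" unfolding p_def by measurable
  have p_lim: "AE x in ?M. (\<lambda>n. f n x) \<longlonglongrightarrow> p x"
    using conv by eventually_elim (simp add: p_def convergent_LIMSEQ_iff)
  have tail: "(\<integral>\<^sup>+x. ennreal ((norm (p x - f n x))\<^sup>2) \<partial>?M) \<le> ennreal ((1/4)^n)" for n
  proof -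
    have "(\<integral>\<^sup>+x. ennreal ((norm (p x - f n x))\<^sup>2) \<partial>?M) =
        (\<integral>\<^sup>+x. liminf (\<lambda>m. ennreal ((norm (f m x - f n x))\<^sup>2)) \<partial>?M)"
    proof (rule nn_integral_cong_AE)
      show "AE x in ?M. ennreal ((norm (p x - f n x))\<^sup>2) =
          liminf (\<lambda>m. ennreal ((norm (f m x - f n x))\<^sup>2))"
        using p_lim
      proof eventually_elim
        fix x assume "(\<lambda>n. f n x) \<longlonglongrightarrow> p x"
        then have "(\<lambda>m. ennreal ((norm (f m x - f n x))\<^sup>2)) \<longlonglongrightarrow> ennreal ((norm (p x - f n x))\<^sup>2)"
          by (intro tendsto_intros tendsto_ennrealI)
        then show "ennreal ((norm (p x - f n x))\<^sup>2) =
            liminf (\<lambda>m. ennreal ((norm (f m x - f n x))\<^sup>2))"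
          by (rule lim_imp_Liminf[symmetric, OF sequentially_bot])
      qed
    qed
    also have "\<dots> \<le> liminf (\<lambda>m. \<integral>\<^sup>+x. ennreal ((norm (f m x - f n x))\<^sup>2) \<partial>?M)"
      by (rule nn_integral_liminf) measurable
    also have "\<dots> \<le> limsup (\<lambda>m. \<integral>\<^sup>+x. ennreal ((norm (f m x - f n x))\<^sup>2) \<partial>?M)"
      by (rule Liminf_le_Limsup) simp
    also have "\<dots> \<le> ennreal ((1/4)^n)"
      by (rule Limsup_bounded) (use nn in \<open>auto simp: eventually_sequentially\<close>)
    finally show ?thesis .
  qed
  have diff_L2: "(\<lambda>x. p x - f n x) \<in> L2 \<Omega>" for n
    unfolding L2_iff
  proof
    show "integrable ?M (\<lambda>x. (norm (p x - f n x))\<^sup>2)"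
      by (rule integrableI_bounded)
        (use tail[of n] in \<open>auto intro: le_less_trans\<close>)
  qed measurable
  have bound: "(L2_norm \<Omega> (\<lambda>x. p x - f n x))\<^sup>2 \<le> (1/4)^n" for n
    using tail[of n] diff_L2[of n] unfolding L2_norm_square L2_iff
    by (subst (asm) nn_integral_eq_integral) auto
  have "p \<in> L2 \<Omega>"
    using L2_add_scale(1)[OF diff_L2[of 0] f[of 0], of 1] by simp
  moreover have "(\<lambda>n. L2_norm \<Omega> (\<lambda>x. p x - f n x)) \<longlonglongrightarrow> 0"
  proof (rule tendsto_sandwich[of "\<lambda>_. 0"])
    show "\<forall>\<^sub>F n in sequentially. L2_norm \<Omega> (\<lambda>x. p x - f n x) \<le> (1/2)^n"
    proof (intro always_eventually allI)
      fix n
      have "((1/4::real))^n = ((1/2)^2)^n" by (simp add: power2_eq_square)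
      also have "\<dots> = ((1/2)^n)\<^sup>2" by (metis power_mult mult.commute)
      finally show "L2_norm \<Omega> (\<lambda>x. p x - f n x) \<le> (1/2)^n"
        using bound[of n] by - (rule power2_le_imp_le, simp_all)
    qed
    show "(\<lambda>n. (1/2::real)^n) \<longlonglongrightarrow> 0" by (rule LIMSEQ_realpow_zero) auto
  qed (auto simp: L2_norm_nonneg)
  ultimately show ?thesis by (rule that)
qed

text \<open>
  The orthogonal projection onto the closure of a subspace, obtained from a minimising sequence
  for the distance, which is Cauchy by the parallelogram law. The sequence \<open>w\<close> expresses that
  \<open>p\<close> belongs to the closure.
\<close>

lemma L2_projection:
  fixes g :: "'a::euclidean_space \<Rightarrow> 'b::euclidean_space"
  assumes V: "V \<subseteq> L2 \<Omega>" "V \<noteq> {}" and g: "g \<in> L2 \<Omega>"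
    and lin: "\<And>w z t. w \<in> V \<Longrightarrow> z \<in> V \<Longrightarrow> (\<lambda>x. w x + t *\<^sub>R z x) \<in> V"
  shows "\<exists>p\<in>L2 \<Omega>. \<exists>w. (\<forall>n::nat. w n \<in> V) \<and>
    (\<lambda>n. L2_norm \<Omega> (\<lambda>x. p x - w n x)) \<longlonglongrightarrow> 0 \<and>
    (\<forall>z\<in>V. (LINT x|lebesgue_on \<Omega>. (p x - g x) \<bullet> z x) = 0)"
proof -
  define N where "N f = (L2_norm \<Omega> f)\<^sup>2" for f :: "'a \<Rightarrow> 'b"
  define d where "d = (INF w\<in>V. N (\<lambda>x. g x - w x))"
  have bdd: "bdd_below ((\<lambda>w. N (\<lambda>x. g x - w x)) ` V)"
    by (rule bdd_belowI[of _ 0]) (auto simp: N_def)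
  have d_le: "d \<le> N (\<lambda>x. g x - w x)" if "w \<in> V" for w
    unfolding d_def by (rule cINF_lower[OF bdd that])
  have "\<exists>w\<in>V. N (\<lambda>x. g x - w x) < d + (1/4)^n / 4" for n
    using cINF_less_iff[OF V(2) bdd, of "d + (1/4)^n / 4"] by (simp add: d_def)
  then obtain w where wV: "\<And>n. w n \<in> V" and wd: "\<And>n. N (\<lambda>x. g x - w n x) < d + (1/4)^n / 4"
    by metis
  have wL: "w n \<in> L2 \<Omega>" for n using wV V by auto
  have gw: "(\<lambda>x. g x - w n x) \<in> L2 \<Omega>" for n by (rule L2_diff[OF g wL])
  have fast: "N (\<lambda>x. w m x - w n x) \<le> (1/4)^n" if "n \<le> m" for m n
  proof -
    define a where "a = (\<lambda>x. g x - w n x)"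
    define b where "b = (\<lambda>x. g x - w m x)"
    have ab: "a \<in> L2 \<Omega>" "b \<in> L2 \<Omega>" using gw by (auto simp: a_def b_def)
    have mid: "(\<lambda>x. w n x + (1/2) *\<^sub>R (w m x + (-1) *\<^sub>R w n x)) \<in> V"
      by (intro lin wV)
    have "4 * d \<le> 4 * N (\<lambda>x. g x - (w n x + (1/2) *\<^sub>R (w m x + (-1) *\<^sub>R w n x)))"
      using d_le[OF mid] by simp
    also have "\<dots> = N (\<lambda>x. a x + 1 *\<^sub>R b x)"
    proof -
      have e: "a x + 1 *\<^sub>R b x = 2 *\<^sub>R (g x - (w n x + (1/2) *\<^sub>R (w m x + (-1) *\<^sub>R w n x)))" for x
        by (simp add: a_def b_def algebra_simps scaleR_2)
      show ?thesis unfolding N_def L2_norm_square e by (simp add: power_mult_distrib)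
    qed
    finally have "4 * d \<le> N (\<lambda>x. a x + 1 *\<^sub>R b x)" .
    moreover have "N (\<lambda>x. a x + 1 *\<^sub>R b x) + N (\<lambda>x. a x + (-1) *\<^sub>R b x) = 2 * N a + 2 * N b"
      unfolding N_def L2_add_scale(2)[OF ab] by simp
    moreover have "N (\<lambda>x. a x + (-1) *\<^sub>R b x) = N (\<lambda>x. w m x - w n x)"
      by (simp add: a_def b_def)
    moreover have "N a < d + (1/4)^n / 4" "N b < d + (1/4)^m / 4"
      using wd by (auto simp: a_def b_def)
    moreover have "(1/4::real)^m \<le> (1/4)^n" using that by (intro power_decreasing) auto
    ultimately show ?thesis by linarith
  qed
  obtain p where p: "p \<in> L2 \<Omega>" and lim: "(\<lambda>n. L2_norm \<Omega> (\<lambda>x. p x - w n x)) \<longlonglongrightarrow> 0"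
    using L2_complete_fast[of w \<Omega>] wL fast unfolding N_def by blast
  have "(LINT x|lebesgue_on \<Omega>. (p x - g x) \<bullet> z x) = 0" if z: "z \<in> V" for z
  proof -
    have zL: "z \<in> L2 \<Omega>" using z V by auto
    define c where "c n = (LINT x|lebesgue_on \<Omega>. (g x - w n x) \<bullet> z x)" for n
    define c0 where "c0 = (LINT x|lebesgue_on \<Omega>. (g x - p x) \<bullet> z x)"
    have "(\<lambda>n. c n - c0) \<longlonglongrightarrow> 0"
    proof (rule Lim_null_comparison)
      show "\<forall>\<^sub>F n in sequentially. norm (c n - c0) \<le> L2_norm \<Omega> (\<lambda>x. p x - w n x) * L2_norm \<Omega> z"
      proof (intro always_eventually allI)
        fix n
        have "c n - c0 = (LINT x|lebesgue_on \<Omega>. (p x - w n x) \<bullet> z x)"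
          unfolding c_def c0_def
          by (subst Bochner_Integration.integral_diff[symmetric])
            (auto intro!: L2_inner_integrable L2_diff g wL p zL Bochner_Integration.integral_cong
              simp: inner_diff_left)
        then show "norm (c n - c0) \<le> L2_norm \<Omega> (\<lambda>x. p x - w n x) * L2_norm \<Omega> z"
          using L2_Cauchy_Schwarz[OF L2_diff[OF p wL] zL] by simp
      qed
      show "(\<lambda>n. L2_norm \<Omega> (\<lambda>x. p x - w n x) * L2_norm \<Omega> z) \<longlonglongrightarrow> 0"
        using tendsto_mult[OF lim tendsto_const] by simp
    qed
    then have clim: "c \<longlonglongrightarrow> c0" by (simp add: LIM_zero_iff)
    \<comment> \<open>Minimality makes \<open>2 * t * c0 + t\<^sup>2 * N z\<close> nonnegative for every \<open>t\<close>.\<close>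
    have "c0\<^sup>2 \<le> 0 * N z"
    proof (rule quadratic_nonneg_imp_discriminant)
      show "N z \<ge> 0" by (simp add: N_def)
      fix t
      have le: "0 \<le> (1/4)^n / 4 + 2 * t * c n + t\<^sup>2 * N z" for n
      proof -
        have "d \<le> N (\<lambda>x. g x - (w n x + (-t) *\<^sub>R z x))"
          by (intro d_le lin wV z)
        also have "\<dots> = N (\<lambda>x. (g x - w n x) + t *\<^sub>R z x)"
          by (simp add: algebra_simps)
        also have "\<dots> = N (\<lambda>x. g x - w n x) + 2 * t * c n + t\<^sup>2 * N z"
          unfolding N_def c_def by (rule L2_add_scale(2)[OF gw zL])
        finally show ?thesis using wd[of n] by simp
      qed
      have "(\<lambda>n. (1/4)^n / 4 + 2 * t * c n + t\<^sup>2 * N z) \<longlonglongrightarrow> 0 / 4 + 2 * t * c0 + t\<^sup>2 * N z"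
        by (intro tendsto_intros clim LIMSEQ_realpow_zero) auto
      then show "0 \<le> 0 + 2 * t * c0 + t\<^sup>2 * N z"
        using le by (intro tendsto_lowerbound[where F = sequentially]) auto
    qed
    then have "c0 = 0" by simp
    moreover have "(LINT x|lebesgue_on \<Omega>. (p x - g x) \<bullet> z x) = - c0"
      unfolding c0_def
      by (subst Bochner_Integration.integral_minus[symmetric])
         (auto intro!: Bochner_Integration.integral_cong simp: inner_diff_left)
    ultimately show ?thesis by simp
  qed
  with p wV lim show ?thesis by blast
qed

section \<open>Smooth functions\<close>

lemma Ck_Suc_imp_Ck: "Ck (Suc k) f \<Longrightarrow> Ck k f"
proof (induction k arbitrary: f)
  case 0
  then show ?case by (simp add: differentiable_imp_continuous_on)
next
  case (Suc k)
  have "Ck k (\<lambda>x. frechet_derivative f (at x) i)" if "i \<in> Basis" for i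
    using Suc.prems that by (intro Suc.IH) (simp only: Ck.simps, blast)
  then show ?case using Suc.prems by simp
qed

lemma Ck_SucI:
  assumes "\<And>x. (f has_derivative f' x) (at x)" "\<And>i. i \<in> Basis \<Longrightarrow> Ck k (\<lambda>x. f' x i)"
  shows "Ck (Suc k) f"
proof -
  have "frechet_derivative f (at x) = f' x" for x
    using frechet_derivative_at[OF assms(1)] by simp
  then show ?thesis using assms by (auto simp: differentiable_on_def differentiable_def)
qed

lemma Ck_SucD:
  assumes "Ck (Suc k) f"
  shows "(f has_derivative frechet_derivative f (at x)) (at x)"
    and "i \<in> Basis \<Longrightarrow> Ck k (\<lambda>x. frechet_derivative f (at x) i)"
  using assms by (auto simp: differentiable_on_def frechet_derivative_works)

lemma Ck_const: "Ck k (\<lambda>x. c)"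
proof (induction k arbitrary: c)
  case (Suc k)
  show ?case by (rule Ck_SucI[of _ "\<lambda>_ _. 0"]) (auto intro: Suc.IH)
qed simp

lemma Ck_add: "Ck k f \<Longrightarrow> Ck k g \<Longrightarrow> Ck k (\<lambda>x. f x + g x)"
proof (induction k arbitrary: f g)
  case 0
  then show ?case by (simp add: continuous_on_add)
next
  case (Suc k)
  show ?case
    by (rule Ck_SucI[OF has_derivative_add[OF Ck_SucD(1)[OF Suc.prems(1)] Ck_SucD(1)[OF Suc.prems(2)]]])
      (intro Suc.IH Ck_SucD(2) Suc.prems)
qed

lemma Ck_mult: "Ck k f \<Longrightarrow> Ck k g \<Longrightarrow> Ck k (\<lambda>x. f x * g x)"
proof (induction k arbitrary: f g)
  case 0
  then show ?case by (simp add: continuous_on_mult)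
next
  case (Suc k)
  show ?case
    by (rule Ck_SucI[OF has_derivative_mult[OF Ck_SucD(1)[OF Suc.prems(1)] Ck_SucD(1)[OF Suc.prems(2)]]])
      (intro Ck_add Suc.IH Ck_SucD(2) Suc.prems Ck_Suc_imp_Ck)
qed

lemma Ck_inner: "Ck k (\<lambda>x. x \<bullet> c)"
proof (induction k)
  case 0
  show ?case by (auto intro!: continuous_intros)
next
  case (Suc k)
  show ?case
    by (rule Ck_SucI[of _ "\<lambda>_ x. x \<bullet> c"]) (auto intro!: derivative_eq_intros Ck_const)
qed

lemma Ck_norm_square: "Ck k (\<lambda>x. x \<bullet> x)"
proof (induction k)
  case 0
  show ?case by (auto intro!: continuous_intros)
next
  case (Suc k)
  show ?case
  proof (rule Ck_SucI)
    show "((\<lambda>x. x \<bullet> x) has_derivative (\<lambda>h. 2 * (x \<bullet> h))) (at x)" for x :: 'a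
      by (auto intro!: derivative_eq_intros simp: inner_commute)
    show "Ck k (\<lambda>x. 2 * (x \<bullet> i))" for i :: 'a
      by (intro Ck_mult Ck_const Ck_inner)
  qed
qed

text \<open>
  The functions \<open>exp (- 1 / t) / t ^ m\<close>, extended by zero to \<open>t \<le> 0\<close>. The derivative of
  each is a linear combination of others, so smoothness of the case \<open>m = 0\<close> follows by an
  induction on the order of differentiation that runs over the whole family.
\<close>

definition flat_exp :: "nat \<Rightarrow> real \<Rightarrow> real" where
  "flat_exp m t = (if t \<le> 0 then 0 else exp (- 1 / t) / t ^ m)"

lemma flat_exp_tendsto_0: "(flat_exp m \<longlongrightarrow> 0) (at 0)"
proof -
  have "((\<lambda>t. (inverse t) ^ m / exp (inverse t)) \<longlongrightarrow> 0) (at_right (0::real))"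
    by (rule filterlim_compose[OF tendsto_power_div_exp_0 filterlim_inverse_at_top_right])
  moreover have "\<forall>\<^sub>F t in at_right 0. (inverse t) ^ m / exp (inverse t) = flat_exp m t"
    by (auto simp: eventually_at_right_less flat_exp_def exp_minus field_simps
        intro!: eventually_mono[OF eventually_at_right_less])
  ultimately have "(flat_exp m \<longlongrightarrow> 0) (at_right 0)" by (rule Lim_transform_eventually)
  moreover have "(flat_exp m \<longlongrightarrow> 0) (at_left 0)"
    by (rule Lim_transform_eventually[OF tendsto_const])
      (auto simp: eventually_at_left_field flat_exp_def intro: exI[of _ "-1"])
  ultimately show ?thesis by (simp add: filterlim_split_at)
qed

lemma flat_exp_has_derivative:
  "(flat_exp m has_real_derivative (flat_exp (m + 2) t - real m * flat_exp (m + 1) t)) (at t)"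
proof -
  consider "t > 0" | "t < 0" | "t = 0" by linarith
  then show ?thesis
  proof cases
    case 1
    have "((\<lambda>t. exp (- 1 / t) / t ^ m) has_real_derivative
        (1 / t\<^sup>2 * exp (- 1 / t)) / t ^ m - real m * exp (- 1 / t) / t ^ (m + 1)) (at t)"
    proof (cases m)
      case 0
      then show ?thesis using 1
        by (auto intro!: derivative_eq_intros simp: field_simps power2_eq_square)
    next
      case (Suc j)
      have "((\<lambda>t. exp (- 1 / t) / t ^ Suc j) has_real_derivative
          (1 / t\<^sup>2 * exp (- 1 / t)) / t ^ Suc j - real (Suc j) * exp (- 1 / t) / t ^ (Suc j + 1)) (at t)"
        by (rule DERIV_cong, rule DERIV_divide, rule DERIV_fun_exp, rule DERIV_divide,
            rule DERIV_const, rule DERIV_ident, use 1 in simp, rule DERIV_pow)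
          (use 1 in \<open>simp_all add: field_simps power2_eq_square\<close>)
      then show ?thesis by (simp add: Suc)
    qed
    moreover have "(1 / t\<^sup>2 * exp (- 1 / t)) / t ^ m - real m * exp (- 1 / t) / t ^ (m + 1) =
        flat_exp (m + 2) t - real m * flat_exp (m + 1) t"
      using 1 by (simp add: flat_exp_def power_add power2_eq_square mult_ac)
    ultimately have "((\<lambda>t. exp (- 1 / t) / t ^ m) has_real_derivative
        (flat_exp (m + 2) t - real m * flat_exp (m + 1) t)) (at t)" by simp
    then show ?thesis
      by (rule has_field_derivative_transform_within_open[where S = "{0<..}"])
        (use 1 in \<open>auto simp: flat_exp_def\<close>)
  next
    case 2
    have "((\<lambda>t. 0) has_real_derivative 0) (at t)" by simp
    then have "(flat_exp m has_real_derivative 0) (at t)"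
      by (rule has_field_derivative_transform_within_open[where S = "{..<0}"])
        (use 2 in \<open>auto simp: flat_exp_def\<close>)
    then show ?thesis using 2 by (simp add: flat_exp_def)
  next
    case 3
    \<comment> \<open>The difference quotient at 0 is the next member of the family.\<close>
    have "(\<lambda>h. (flat_exp m (0 + h) - flat_exp m 0) / h) = flat_exp (Suc m)"
      by (auto simp: flat_exp_def)
    then have "(flat_exp m has_real_derivative 0) (at 0)"
      using flat_exp_tendsto_0[of "Suc m"] by (simp add: DERIV_def)
    then show ?thesis using 3 by (simp add: flat_exp_def)
  qed
qed

lemma flat_exp_comp_has_derivative:
  assumes "(q has_derivative q') (at x)"
  shows "((\<lambda>x. flat_exp m (q x)) has_derivative
    (\<lambda>h. (flat_exp (m + 2) (q x) - real m * flat_exp (m + 1) (q x)) * q' h)) (at x)"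
  using has_derivative_compose[OF assms flat_exp_has_derivative[THEN has_field_derivative_imp_has_derivative]]
  by simp

lemma Ck_flat_exp_comp:
  assumes "\<And>j. Ck j q"
  shows "Ck k (\<lambda>x. flat_exp m (q x))"
proof (induction k arbitrary: m)
  case 0
  have "continuous_on UNIV (flat_exp m)"
    by (intro DERIV_continuous_on) (auto intro: flat_exp_has_derivative[THEN DERIV_subset])
  moreover have "continuous_on UNIV q" using assms[of 0] by simp
  ultimately show ?case by (auto intro: continuous_on_compose2)
next
  case (Suc k)
  show ?case
  proof (rule Ck_SucI[OF flat_exp_comp_has_derivative[OF Ck_SucD(1)[OF assms]]])
    fix i :: 'a assume i: "i \<in> Basis"
    have "Ck k (\<lambda>x. (flat_exp (m + 2) (q x) + (- real m) * flat_exp (m + 1) (q x)) *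
        frechet_derivative q (at x) i)"
      by (intro Ck_mult Ck_add Ck_const Suc.IH Ck_SucD(2)[OF assms] i)
    then show "Ck k (\<lambda>x. (flat_exp (m + 2) (q x) - real m * flat_exp (m + 1) (q x)) *
        frechet_derivative q (at x) i)"
      by simp
  qed
qed

lemma Cinf_has_derivative:
  assumes "f \<in> Cinf"
  shows "(f has_derivative (\<lambda>h. grad f x \<bullet> h)) (at x)"
proof -
  have d: "(f has_derivative frechet_derivative f (at x)) (at x)"
    using assms Ck_SucD(1)[of 0] by (auto simp: Cinf_def simp del: Ck.simps)
  have "frechet_derivative f (at x) h = grad f x \<bullet> h" for h
  proof -
    interpret linear "frechet_derivative f (at x)"
      using d by (rule has_derivative_linear)
    have "frechet_derivative f (at x) h = frechet_derivative f (at x) (\<Sum>i\<in>Basis. (h \<bullet> i) *\<^sub>R i)"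
      by (simp add: euclidean_representation)
    also have "\<dots> = (\<Sum>i\<in>Basis. (h \<bullet> i) * frechet_derivative f (at x) i)"
      by (simp add: sum scaleR)
    also have "\<dots> = grad f x \<bullet> h"
      unfolding grad_def inner_sum_left by (simp add: inner_commute mult.commute)
    finally show ?thesis .
  qed
  then show ?thesis using d by (metis (no_types, lifting) ext)
qed

lemma grad_eqI:
  assumes "(f has_derivative (\<lambda>h. w \<bullet> h)) (at x)"
  shows "grad f x = w"
proof -
  have "frechet_derivative f (at x) = (\<lambda>h. w \<bullet> h)"
    using frechet_derivative_at[OF assms] by simp
  then show ?thesis unfolding grad_def by (simp add: euclidean_representation)
qed

lemma continuous_on_grad:
  assumes "f \<in> Cinf"
  shows "continuous_on UNIV (grad f)"
proof -
  have "Ck (Suc 0) f" using assms by (auto simp: Cinf_def simp del: Ck.simps)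
  then show ?thesis unfolding grad_def[abs_def] by (auto intro!: continuous_intros)
qed

lemma continuous_on_Cinf: "f \<in> Cinf \<Longrightarrow> continuous_on UNIV f"
  by (auto simp: Cinf_def dest: spec[of _ 0])

lemma Cinf_add_scale:
  assumes f: "f \<in> Cinf" and g: "g \<in> Cinf"
  shows "(\<lambda>x. f x + t * g x) \<in> Cinf"
    and "grad (\<lambda>x. f x + t * g x) = (\<lambda>x. grad f x + t *\<^sub>R grad g x)"
proof -
  show "(\<lambda>x. f x + t * g x) \<in> Cinf"
    using assms unfolding Cinf_def by (auto intro!: Ck_add Ck_mult Ck_const simp del: Ck.simps)
  show "grad (\<lambda>x. f x + t * g x) = (\<lambda>x. grad f x + t *\<^sub>R grad g x)"
    by (intro ext grad_eqI)
      (auto intro!: derivative_eq_intros Cinf_has_derivative f g simp: inner_add_left)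
qed

lemma Cinf_mult:
  assumes f: "f \<in> Cinf" and g: "g \<in> Cinf"
  shows "(\<lambda>x. f x * g x) \<in> Cinf"
    and "grad (\<lambda>x. f x * g x) = (\<lambda>x. f x *\<^sub>R grad g x + g x *\<^sub>R grad f x)"
proof -
  show "(\<lambda>x. f x * g x) \<in> Cinf"
    using assms unfolding Cinf_def by (auto intro!: Ck_mult simp del: Ck.simps)
  show "grad (\<lambda>x. f x * g x) = (\<lambda>x. f x *\<^sub>R grad g x + g x *\<^sub>R grad f x)"
    by (intro ext grad_eqI)
      (auto intro!: derivative_eq_intros Cinf_has_derivative f g simp: inner_add_left)
qed

lemma borel_measurable_lebesgue_on_continuous:
  assumes "continuous_on UNIV f"
  shows "f \<in> borel_measurable (lebesgue_on \<Omega>)"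
proof -
  have "f \<in> borel_measurable lborel"
    using borel_measurable_continuous_onI[OF assms] by simp
  then show ?thesis by (intro measurable_restrict_space1 measurable_completion)
qed

lemma integrable_continuous_lebesgue_on_bounded:
  fixes f :: "'a::euclidean_space \<Rightarrow> 'b::euclidean_space"
  assumes "bounded \<Omega>" "\<Omega> \<in> sets lebesgue" "continuous_on UNIV f"
  shows "integrable (lebesgue_on \<Omega>) f"
proof -
  have "bounded (f ` closure \<Omega>)"
    using assms by (intro compact_imp_bounded compact_continuous_image)
      (auto intro: continuous_on_subset)
  then obtain B where B: "\<And>x. x \<in> closure \<Omega> \<Longrightarrow> norm (f x) \<le> B"
    unfolding bounded_iff by blast
  interpret finite_measure "lebesgue_on \<Omega>"
    using assms by (intro finite_measure_lebesgue_on bounded_set_imp_lmeasurable)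
  show ?thesis
    by (rule integrable_const_bound[of _ B])
      (use B closure_subset[of \<Omega>] assms borel_measurable_lebesgue_on_continuous
        in \<open>auto intro!: AE_I2 simp: space_restrict_space\<close>)
qed

lemma continuous_imp_L2:
  fixes f :: "'a::euclidean_space \<Rightarrow> 'b::euclidean_space"
  assumes "bounded \<Omega>" "\<Omega> \<in> sets lebesgue" "continuous_on UNIV f"
  shows "f \<in> L2 \<Omega>"
  unfolding L2_iff
  by (intro conjI integrable_continuous_lebesgue_on_bounded borel_measurable_lebesgue_on_continuous
      assms continuous_intros)

section \<open>Integration by parts\<close>

lemma grad_eq_0_outside_support:
  assumes "x \<notin> closure {x. f x \<noteq> 0}"
  shows "grad f x = 0"
proof (rule grad_eqI)
  have "((\<lambda>x. 0) has_derivative (\<lambda>h. 0 \<bullet> h)) (at x)" by simp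
  then show "(f has_derivative (\<lambda>h. 0 \<bullet> h)) (at x)"
    by (rule has_derivative_transform_within_open[where s = "- closure {x. f x \<noteq> 0}"])
      (use assms closure_subset[of "{x. f x \<noteq> 0}"] in auto)
qed

text \<open>
  By translation invariance the difference quotients of \<^term>\<open>f\<close> in the direction \<^term>\<open>e\<close>
  integrate to zero. The mean value theorem bounds them by a constant on a fixed ball, so
  dominated convergence passes this on to the directional derivative.
\<close>

lemma integral_grad_bounded_support:
  fixes f :: "'a::euclidean_space \<Rightarrow> real"
  assumes f: "f \<in> Cinf" and bd: "bounded {x. f x \<noteq> 0}"
  shows "(LINT x|lebesgue. grad f x \<bullet> e) = 0"
proof -
  obtain R where "{x. f x \<noteq> 0} \<subseteq> cball 0 R"
    using bd by (auto simp: bounded_iff subset_iff)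
  then have R: "f x = 0" "grad f x = 0" if "norm x > R" for x
    using that closure_minimal[of "{x. f x \<noteq> 0}" "cball 0 R"]
    by (auto intro!: grad_eq_0_outside_support simp: subset_iff dist_norm)
  have cont: "continuous_on UNIV f" "continuous_on UNIV (\<lambda>x. grad f x \<bullet> e)"
    using continuous_on_Cinf[OF f] continuous_on_grad[OF f] by (auto intro!: continuous_intros)
  have "bounded ((\<lambda>x. grad f x \<bullet> e) ` cball 0 R)"
    by (intro compact_imp_bounded compact_continuous_image compact_cball
        continuous_on_subset[OF cont(2)]) auto
  then obtain B0 where B0: "\<And>x. norm x \<le> R \<Longrightarrow> \<bar>grad f x \<bullet> e\<bar> \<le> B0"
    unfolding bounded_iff by (metis imageI mem_cball_0 real_norm_def)
  define B where "B = max B0 0"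
  have B: "\<bar>grad f x \<bullet> e\<bar> \<le> B" for x
    using B0[of x] R(2)[of x] by (cases "norm x \<le> R") (auto simp: B_def)
  define t where "t n = inverse (real (Suc n))" for n
  have t: "0 < t n" "t n \<le> 1" for n
    by (auto simp: t_def field_simps)
  have line: "((\<lambda>s. f (x + s *\<^sub>R e)) has_real_derivative grad f (x + s *\<^sub>R e) \<bullet> e) (at s)" for x s
  proof -
    have "((\<lambda>s. f (x + s *\<^sub>R e)) has_derivative (\<lambda>h. grad f (x + s *\<^sub>R e) \<bullet> (h *\<^sub>R e))) (at s)"
      by (rule has_derivative_compose[OF _ Cinf_has_derivative[OF f]])
        (auto intro!: derivative_eq_intros)
    then show ?thesis by (simp add: has_field_derivative_def mult.commute[of _ "_ \<bullet> _"] mult_commute_abs)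
  qed
  define s where "s n x = (f (x + t n *\<^sub>R e) - f x) / t n" for n x
  have s_bound: "norm (s n x) \<le> B * indicator (cball 0 (R + norm e)) x" for n x
  proof (cases "norm x \<le> R + norm e")
    case True
    obtain z where "f (x + t n *\<^sub>R e) - f (x + 0 *\<^sub>R e) = (t n - 0) * (grad f (x + z *\<^sub>R e) \<bullet> e)"
      using MVT2[OF t(1)[of n], of "\<lambda>s. f (x + s *\<^sub>R e)" "\<lambda>s. grad f (x + s *\<^sub>R e) \<bullet> e"] line
      by blast
    then have "s n x = grad f (x + z *\<^sub>R e) \<bullet> e" using t(1)[of n] by (simp add: s_def)
    then show ?thesis using B True by (simp add: dist_norm)
  next
    case False
    have "norm (t n *\<^sub>R e) \<le> norm e" using t[of n] by (simp add: mult_left_le_one_le)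
    then have "norm (x + t n *\<^sub>R e) > R"
      using False norm_triangle_ineq4[of "x + t n *\<^sub>R e" "t n *\<^sub>R e"] by simp
    moreover have "norm x > R" using False norm_ge_zero[of e] by linarith
    ultimately show ?thesis using False R(1) by (simp add: s_def)
  qed
  have meas [measurable]: "f \<in> borel_measurable borel" "(\<lambda>x. grad f x \<bullet> e) \<in> borel_measurable borel"
    using cont by (auto intro: borel_measurable_continuous_onI)
  have int_f: "integrable lborel f"
  proof -
    have "(\<lambda>x. indicator (cball 0 R) x *\<^sub>R f x) = f"
      using R(1) by (auto simp: indicator_def dist_norm fun_eq_iff not_le)
    then show ?thesis
      using borel_integrable_compact[of "cball 0 R" f] cont(1) by (auto intro: continuous_on_subset)
  qed
  have s_int: "integral\<^sup>L lborel (s n) = 0" for n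
  proof -
    have "integrable (distr lborel borel ((+) (t n *\<^sub>R e))) f"
      using int_f by (simp add: lborel_distr_plus)
    then have "integrable lborel (\<lambda>x. f (t n *\<^sub>R e + x))"
      by (subst (asm) integrable_distr_eq) auto
    moreover have "(LINT x|lborel. f (t n *\<^sub>R e + x)) = integral\<^sup>L lborel f"
      using integral_distr[of "(+) (t n *\<^sub>R e)" lborel borel f] by (simp add: lborel_distr_plus)
    ultimately show ?thesis using int_f by (simp add: s_def[abs_def] add.commute)
  qed
  have "(\<lambda>n. integral\<^sup>L lborel (s n)) \<longlonglongrightarrow> (LINT x|lborel. grad f x \<bullet> e)"
  proof (rule integral_dominated_convergence[where w = "\<lambda>x. B * indicator (cball 0 (R + norm e)) x"])
    show "AE x in lborel. (\<lambda>n. s n x) \<longlonglongrightarrow> grad f x \<bullet> e"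
    proof (intro AE_I2)
      fix x
      have "((\<lambda>h. (f (x + h *\<^sub>R e) - f x) / h) \<longlongrightarrow> grad f x \<bullet> e) (at 0)"
        using line[of x 0] by (simp add: DERIV_def)
      moreover have "filterlim t (at 0) sequentially"
        unfolding t_def[abs_def] filterlim_at
        using LIMSEQ_inverse_real_of_nat by auto
      ultimately show "(\<lambda>n. s n x) \<longlonglongrightarrow> grad f x \<bullet> e"
        unfolding s_def by (rule filterlim_compose)
    qed
    show "AE x in lborel. norm (s n x) \<le> B * indicator (cball 0 (R + norm e)) x" for n
      using s_bound by simp
    show "integrable lborel (\<lambda>x. B * indicator (cball 0 (R + norm e)) x)"
      by (intro integrable_mult_right integrable_real_indicator) (use emeasure_lborel_cball_finite in auto)
    show "s n \<in> borel_measurable lborel" for n unfolding s_def[abs_def] by measurable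
  qed measurable
  then have "(LINT x|lborel. grad f x \<bullet> e) = 0" by (simp add: s_int LIMSEQ_const_iff)
  then show ?thesis by (subst integral_completion) (use meas in auto)
qed

lemma test_functionsD:
  assumes "\<phi> \<in> test_functions \<Omega>"
  shows "\<phi> \<in> Cinf" "bounded {x. \<phi> x \<noteq> 0}" "closure {x. \<phi> x \<noteq> 0} \<subseteq> \<Omega>"
  using assms
  by (auto simp: test_functions_def intro: bounded_subset[OF compact_imp_bounded closure_subset])

lemma test_functionsI:
  assumes "\<phi> \<in> Cinf" "closure {x. \<phi> x \<noteq> 0} \<subseteq> S" "compact S" "S \<subseteq> \<Omega>"
  shows "\<phi> \<in> test_functions \<Omega>"
  using assms
    bounded_subset[OF compact_imp_bounded[OF assms(3)] subset_trans[OF closure_subset assms(2)]]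
  unfolding test_functions_def by auto

lemma test_functions_compact: "\<phi> \<in> test_functions \<Omega> \<Longrightarrow> compact (closure {x. \<phi> x \<noteq> 0})"
  by (simp add: test_functions_def)

lemma test_functions_add_scale:
  assumes "\<phi> \<in> test_functions \<Omega>" "\<psi> \<in> test_functions \<Omega>"
  shows "(\<lambda>x. \<phi> x + t * \<psi> x) \<in> test_functions \<Omega>"
proof (rule test_functionsI)
  let ?S = "closure {x. \<phi> x \<noteq> 0} \<union> closure {x. \<psi> x \<noteq> 0}"
  show "closure {x. \<phi> x + t * \<psi> x \<noteq> 0} \<subseteq> ?S"
    unfolding closure_Un[symmetric] by (rule closure_mono) auto
  show "compact ?S" using assms by (auto intro: test_functions_compact)
  show "?S \<subseteq> \<Omega>" using assms[THEN test_functionsD(3)] by auto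
qed (intro Cinf_add_scale assms[THEN test_functionsD(1)])

lemma test_functions_mult:
  assumes "u \<in> Cinf" "\<phi> \<in> test_functions \<Omega>"
  shows "(\<lambda>x. u x * \<phi> x) \<in> test_functions \<Omega>"
  by (rule test_functionsI[OF Cinf_mult(1) closure_mono test_functions_compact[OF assms(2)]])
    (use assms test_functionsD[OF assms(2)] in auto)

lemma integral_grad_test_function:
  assumes \<Omega>: "\<Omega> \<in> sets lebesgue" and \<phi>: "\<phi> \<in> test_functions \<Omega>"
  shows "(LINT x|lebesgue_on \<Omega>. grad \<phi> x \<bullet> e) = 0"
proof -
  have "grad \<phi> x = 0" if "x \<notin> \<Omega>" for x
    using that test_functionsD(3)[OF \<phi>] by (intro grad_eq_0_outside_support) auto
  then have "(\<lambda>x. if x \<in> \<Omega> then grad \<phi> x \<bullet> e else 0) = (\<lambda>x. grad \<phi> x \<bullet> e)" by auto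
  then have "(LINT x|lebesgue_on \<Omega>. grad \<phi> x \<bullet> e) = (LINT x|lebesgue. grad \<phi> x \<bullet> e)"
    by (metis Lebesgue_Measure.integral_restrict_UNIV[OF \<Omega>, of "\<lambda>x. grad \<phi> x \<bullet> e"])
  also have "\<dots> = 0" by (intro integral_grad_bounded_support test_functionsD[OF \<phi>])
  finally show ?thesis .
qed

lemma has_weak_grad_Cinf:
  fixes u :: "'a::euclidean_space \<Rightarrow> real"
  assumes \<Omega>: "open \<Omega>" "bounded \<Omega>" and u: "u \<in> Cinf"
  shows "has_weak_grad \<Omega> u (grad u)"
  unfolding has_weak_grad_def
proof (intro conjI ballI)
  have m: "\<Omega> \<in> sets lebesgue" using \<Omega> by auto
  note cu = continuous_on_Cinf[OF u] continuous_on_grad[OF u]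
  show "u \<in> L2 \<Omega>" "grad u \<in> L2 \<Omega>"
    using cu by (auto intro: continuous_imp_L2[OF \<Omega>(2) m])
  fix \<phi> assume \<phi>: "\<phi> \<in> test_functions \<Omega>"
  note p = test_functionsD(1)[OF \<phi>]
  note cp = continuous_on_Cinf[OF p] continuous_on_grad[OF p]
  have i: "integrable (lebesgue_on \<Omega>) (\<lambda>x. u x *\<^sub>R grad \<phi> x)"
       "integrable (lebesgue_on \<Omega>) (\<lambda>x. \<phi> x *\<^sub>R grad u x)"
    by (intro integrable_continuous_lebesgue_on_bounded[OF \<Omega>(2) m] continuous_intros cu cp)+
  show "(LINT x|lebesgue_on \<Omega>. u x *\<^sub>R grad \<phi> x) = - (LINT x|lebesgue_on \<Omega>. \<phi> x *\<^sub>R grad u x)"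
  proof (rule euclidean_eqI)
    fix e :: 'a assume "e \<in> Basis"
    have "0 = (LINT x|lebesgue_on \<Omega>. (u x *\<^sub>R grad \<phi> x + \<phi> x *\<^sub>R grad u x) \<bullet> e)"
      using integral_grad_test_function[OF m test_functions_mult[OF u \<phi>], of e]
      by (simp add: Cinf_mult(2)[OF u p])
    also have "\<dots> = (LINT x|lebesgue_on \<Omega>. u x *\<^sub>R grad \<phi> x) \<bullet> e + (LINT x|lebesgue_on \<Omega>. \<phi> x *\<^sub>R grad u x) \<bullet> e"
      using i by (subst integral_inner_left) (auto simp: inner_add_left)
    finally show "(LINT x|lebesgue_on \<Omega>. u x *\<^sub>R grad \<phi> x) \<bullet> e =
        - (LINT x|lebesgue_on \<Omega>. \<phi> x *\<^sub>R grad u x) \<bullet> e"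
      by (simp add: inner_minus_left)
  qed
qed

section \<open>Smooth functions in the energy space\<close>

text \<open>The surface measure of a compact face is the image of Lebesgue measure on a compact prism.\<close>

lemma face_measure_integrable_continuous:
  fixes g :: "'a::euclidean_space \<Rightarrow> real"
  assumes F: "compact F" "F \<noteq> {}" and g: "continuous_on UNIV g"
  shows "integrable (face_measure F) g"
proof -
  let ?P = "{x + t *\<^sub>R unit_normal F | x t. x \<in> F \<and> t \<in> {0..1}}"
  have "?P = (\<lambda>(x, t). x + t *\<^sub>R unit_normal F) ` (F \<times> {0..1})" by auto blast
  also have "compact \<dots>"
    by (intro compact_continuous_image compact_Times F compact_Icc)
      (auto intro!: continuous_intros simp: case_prod_beta)
  finally have P: "compact ?P" .
  have c: "continuous_on UNIV (closest_point (affine hull F))"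
    by (intro continuous_on_closest_point affine_imp_convex affine_affine_hull closed_affine_hull)
      (use F in simp)
  have "integrable (lebesgue_on ?P) (\<lambda>x. g (closest_point (affine hull F) x))"
    using compact_imp_bounded[OF P] compact_imp_closed[OF P] continuous_on_compose2[OF g c]
    by (intro integrable_continuous_lebesgue_on_bounded) auto
  then show ?thesis
    unfolding face_measure_def
    by (subst integrable_distr_eq)
      (auto intro: borel_measurable_continuous_onI g borel_measurable_lebesgue_on_continuous c)
qed

text \<open>
  A smooth function is its own trace, approximated by the constant sequence.
\<close>

lemma Cinf_in_H1D:
  assumes \<Omega>: "open \<Omega>" "bounded \<Omega>" and T: "simplicial_mesh \<Omega> T" and u: "u \<in> Cinf"
    and zero: "\<And>x. x \<in> \<Gamma>\<^sub>D \<Longrightarrow> u x = 0"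
  shows "u \<in> H1D \<Omega> T \<Gamma>\<^sub>D"
proof -
  have wg: "has_weak_grad \<Omega> u (grad u)" by (rule has_weak_grad_Cinf[OF \<Omega> u])
  have "has_trace \<Omega> T u u"
    unfolding has_trace_def
  proof (intro conjI ballI exI[of _ "grad u"] exI[of _ "\<lambda>_. u"])
    show "u \<in> borel_measurable borel"
      by (intro borel_measurable_continuous_onI continuous_on_Cinf u)
    fix F assume "F \<in> boundary_faces \<Omega> T"
    then obtain K where K: "K \<in> T" "F facet_of K" by (auto simp: boundary_faces_def)
    then have "compact K" "convex K"
      using T by (auto simp: simplicial_mesh_def intro: compact_simplex convex_simplex)
    then have "compact F"
      using K(2) by (intro face_of_imp_compact[of K F]) (auto simp: facet_of_def)
    moreover have "F \<noteq> {}" using K(2) by (simp add: facet_of_def)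
    ultimately show "integrable (face_measure F) (\<lambda>x. (u x)\<^sup>2)"
      by (intro face_measure_integrable_continuous continuous_intros continuous_on_Cinf u)
  qed (use wg u in \<open>auto simp: L2_norm_def\<close>)
  then show ?thesis using wg zero by (auto simp: H1D_def H1_def)
qed

lemma H1D_subset_W_space: "H1D \<Omega> T \<Gamma>\<^sub>D \<subseteq> W_space \<Omega> T \<Gamma>\<^sub>D"
proof
  fix v assume v: "v \<in> H1D \<Omega> T \<Gamma>\<^sub>D"
  have "(\<lambda>_. 0) \<in> CR_space \<Omega> T \<Gamma>\<^sub>D"
    unfolding CR_space_def
    by (auto simp: L2_iff intro!: exI[of _ "\<lambda>_. 0"])
  then show "v \<in> W_space \<Omega> T \<Gamma>\<^sub>D" using v unfolding W_space_def by force
qed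

lemma has_broken_grad_Cinf:
  assumes \<Omega>: "open \<Omega>" "bounded \<Omega>" and T: "simplicial_mesh \<Omega> T" and u: "u \<in> Cinf"
  shows "has_broken_grad \<Omega> T u (grad u)"
proof -
  have "bounded (interior K)" if "K \<in> T" for K
    using that T unfolding simplicial_mesh_def
    by (meson bounded_subset compact_imp_bounded compact_simplex interior_subset)
  moreover have "grad u \<in> L2 \<Omega>"
    using has_weak_grad_Cinf[OF \<Omega> u] by (simp add: has_weak_grad_def)
  ultimately show ?thesis
    using has_weak_grad_Cinf[OF _ _ u] unfolding has_broken_grad_def by auto
qed

section \<open>A bump function at the boundary\<close>

text \<open>
  With \<open>s\<close> the height above \<^term>\<open>x0\<close> in the graph direction \<^term>\<open>e\<close> and \<open>y'\<close>, \<open>x0'\<close> the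
  components orthogonal to \<^term>\<open>e\<close>, the bump is supported in the ellipsoid
  \<open>M\<^sup>2 * (norm (y' - x0'))\<^sup>2 + (s + R / 2)\<^sup>2 \<le> R\<^sup>2\<close>, whose centre lies \<open>R / 2\<close> below
  \<^term>\<open>x0\<close>; along \<^term>\<open>e\<close> the bump decreases exactly in the part of the ellipsoid above its
  centre. The ellipsoid is so thin that the graph, of slope at most \<open>L\<close>, descends by at most
  \<open>L * R / M \<le> R / 2\<close> over its half-width. Hence \<^term>\<open>\<Omega>\<close> meets it only above the centre, whereas
  \<^term>\<open>x0\<close> lies in its interior.
\<close>

lemma lipschitz_boundary_bump:
  fixes x0 :: "'a::euclidean_space"
  assumes \<Omega>: "open \<Omega>" "lipschitz_boundary \<Omega>" and x0: "x0 \<in> frontier \<Omega>" and "\<rho> > 0"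
  obtains u e where "u \<in> Cinf" "{x. u x \<noteq> 0} \<subseteq> ball x0 \<rho>"
    "\<And>x. x \<in> \<Omega> \<Longrightarrow> grad u x \<bullet> e \<le> 0" "\<exists>x\<in>\<Omega>. grad u x \<bullet> e < 0"
proof -
  obtain r e h L where r: "r > 0" and e: "norm e = 1" and lip: "L-lipschitz_on {z. z \<bullet> e = 0} h"
    and graph: "\<Omega> \<inter> ball x0 r = {y \<in> ball x0 r. h (y - (y \<bullet> e) *\<^sub>R e) < y \<bullet> e}"
    using \<Omega>(2) x0 unfolding lipschitz_boundary_def by blast
  have L: "L \<ge> 0" using lip by (rule lipschitz_on_nonneg)
  have ee: "e \<bullet> e = 1" using e by (simp add: norm_eq_1)
  define R where "R = min r \<rho> / 2"
  have R: "R > 0" "2 * R \<le> r" "2 * R \<le> \<rho>" using r \<open>\<rho> > 0\<close> by (auto simp: R_def)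
  \<comment> \<open>\<open>M \<ge> 2 * L\<close> gives the slope bound, \<open>M \<ge> 1\<close> keeps the ellipsoid within \<open>ball x0 (2 * R)\<close>.\<close>
  define M where "M = 2 * L + 1"
  define s where "s y = (y - x0) \<bullet> e" for y
  define n2 where "n2 y = (y - x0) \<bullet> (y - x0) - (s y)\<^sup>2" for y
  define q where "q y = R\<^sup>2 - M\<^sup>2 * n2 y - (s y + R / 2)\<^sup>2" for y
  define u where "u y = flat_exp 0 (q y)" for y
  have n2: "n2 y = (norm (y - (y \<bullet> e) *\<^sub>R e - (x0 - (x0 \<bullet> e) *\<^sub>R e)))\<^sup>2" for y
    unfolding n2_def s_def power2_norm_eq_inner
    by (simp add: inner_diff_left inner_diff_right inner_commute ee power2_eq_square algebra_simps)
  have q_smooth: "Ck k q" for k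
  proof -
    have "s = (\<lambda>y. y \<bullet> e + - (x0 \<bullet> e))"
      by (simp add: s_def fun_eq_iff inner_diff_left)
    then have s: "Ck k s" by (simp only: Ck_add Ck_inner Ck_const)
    have "(\<lambda>y. (y - x0) \<bullet> (y - x0)) = (\<lambda>y. y \<bullet> y + (y \<bullet> ((-2) *\<^sub>R x0) + x0 \<bullet> x0))"
      by (simp add: fun_eq_iff inner_diff_left inner_diff_right inner_commute)
    then have d: "Ck k (\<lambda>y. (y - x0) \<bullet> (y - x0))"
      by (simp only: Ck_add Ck_inner Ck_const Ck_norm_square)
    have q_eq: "q = (\<lambda>y. R\<^sup>2 + ((- M\<^sup>2) * ((y - x0) \<bullet> (y - x0) + (-1) * (s y * s y))
        + (-1) * ((s y + R / 2) * (s y + R / 2))))"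
      by (simp add: q_def n2_def fun_eq_iff power2_eq_square)
    show ?thesis
      unfolding q_eq by (intro Ck_add Ck_mult Ck_const s d)
  qed
  have u: "u \<in> Cinf"
    unfolding Cinf_def u_def[abs_def] using Ck_flat_exp_comp[OF q_smooth] by simp
  have grad_u: "grad u y \<bullet> e = flat_exp 2 (q y) * (- 2 * (s y + R / 2))" for y
  proof -
    have s': "(s has_derivative (\<lambda>h. h \<bullet> e)) (at y)"
      unfolding s_def[abs_def] by (auto intro!: derivative_eq_intros)
    have "(q has_derivative (\<lambda>h. - (M\<^sup>2 * (2 * ((y - x0) \<bullet> h) - 2 * s y * (h \<bullet> e)))
        - 2 * (s y + R / 2) * (h \<bullet> e))) (at y)"
      unfolding q_def[abs_def] n2_def[abs_def]
      by (rule has_derivative_eq_rhs, (rule derivative_intros s')+)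
        (simp add: inner_commute algebra_simps)
    from flat_exp_comp_has_derivative[OF this, of 0]
    have "(u has_derivative (\<lambda>h. flat_exp 2 (q y) * (- (M\<^sup>2 * (2 * ((y - x0) \<bullet> h) - 2 * s y * (h \<bullet> e)))
        - 2 * (s y + R / 2) * (h \<bullet> e)))) (at y)"
      unfolding u_def[abs_def] by (simp add: numeral_2_eq_2)
    from fun_cong[OF has_derivative_unique[OF this Cinf_has_derivative[OF u]], of e]
    show ?thesis by (simp add: ee s_def)
  qed
  have pos: "norm (y - x0) < 2 * R"
      "norm (y - (y \<bullet> e) *\<^sub>R e - (x0 - (x0 \<bullet> e) *\<^sub>R e)) * M < R" if "q y > 0" for y
  proof -
    define a where "a = norm (y - (y \<bullet> e) *\<^sub>R e - (x0 - (x0 \<bullet> e) *\<^sub>R e))"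
    have a: "(a * M)\<^sup>2 + (s y + R / 2)\<^sup>2 < R\<^sup>2"
      using that by (simp add: q_def n2 a_def power_mult_distrib mult.commute)
    then have "(a * M)\<^sup>2 < R\<^sup>2" using zero_le_power2[of "s y + R / 2"] by linarith
    then show aM: "a * M < R" using R(1) by (rule power2_less_imp_less[OF _ less_imp_le])
    have "a \<le> a * M" using L by (simp add: M_def a_def mult_le_cancel_left1)
    have "0 \<le> a" by (simp add: a_def)
    then have a1: "a\<^sup>2 \<le> R\<^sup>2" using aM \<open>a \<le> a * M\<close> R(1) by (intro power_mono) auto
    have "(s y + R / 2)\<^sup>2 < R\<^sup>2" using a zero_le_power2[of "a * M"] by linarith
    then have "\<bar>s y + R / 2\<bar> < R"
      using power2_less_imp_less[of "\<bar>s y + R / 2\<bar>" R] R(1) by simp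
    then have "\<bar>s y\<bar> \<le> 3 / 2 * R" using R(1) by (simp add: abs_if split: if_splits)
    then have "(s y)\<^sup>2 \<le> (3 / 2 * R)\<^sup>2" using R(1) by (simp add: abs_le_square_iff[symmetric])
    moreover have "(norm (y - x0))\<^sup>2 = a\<^sup>2 + (s y)\<^sup>2"
      using n2[of y] by (simp add: a_def n2_def power2_norm_eq_inner)
    ultimately have "(norm (y - x0))\<^sup>2 < (2 * R)\<^sup>2" using a1 mult_pos_pos[OF R(1) R(1)]
      by (simp add: power2_eq_square)
    then show "norm (y - x0) < 2 * R" using R(1) by - (rule power2_less_imp_less, simp_all)
  qed
  have x0_below: "x0 \<bullet> e \<le> h (x0 - (x0 \<bullet> e) *\<^sub>R e)"
  proof -
    have "x0 \<notin> \<Omega>" using x0 \<Omega>(1) by (simp add: frontier_def interior_open)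
    moreover have "x0 \<in> \<Omega> \<inter> ball x0 r" if "h (x0 - (x0 \<bullet> e) *\<^sub>R e) < x0 \<bullet> e"
      unfolding graph using r that by simp
    ultimately show ?thesis by (meson IntD1 not_le)
  qed
  have above: "s y + R / 2 > 0" if y: "y \<in> \<Omega>" and qy: "q y > 0" for y
  proof -
    let ?p = "\<lambda>y. y - (y \<bullet> e) *\<^sub>R e"
    have "y \<in> ball x0 r" using pos(1)[OF qy] R by (simp add: dist_norm norm_minus_commute)
    then have "h (?p y) < y \<bullet> e" using graph y by blast
    moreover have "dist (h (?p y)) (h (?p x0)) \<le> L * dist (?p y) (?p x0)"
      using lip by (rule lipschitz_onD) (auto simp: inner_diff_left ee)
    moreover have "L * dist (?p y) (?p x0) \<le> R / 2"
    proof -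
      have "dist (?p y) (?p x0) * M < R" using pos(2)[OF qy] by (simp add: dist_norm)
      moreover have "dist (?p y) (?p x0) * M = 2 * (L * dist (?p y) (?p x0)) + dist (?p y) (?p x0)"
        by (simp add: M_def algebra_simps)
      ultimately show ?thesis using zero_le_dist[of "?p y" "?p x0"] by linarith
    qed
    ultimately show ?thesis using x0_below
      by (simp add: dist_real_def s_def inner_diff_left)
  qed
  have flat_pos: "flat_exp m t > 0 \<longleftrightarrow> t > 0" "flat_exp m t \<ge> 0" for m t
    by (auto simp: flat_exp_def)
  show ?thesis
  proof (rule that[OF u])
    have "u y \<noteq> 0 \<Longrightarrow> q y > 0" for y by (auto simp: u_def flat_exp_def split: if_splits)
    then show "{x. u x \<noteq> 0} \<subseteq> ball x0 \<rho>"
      using pos(1) R by (force simp: dist_norm norm_minus_commute)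
    show "grad u x \<bullet> e \<le> 0" if "x \<in> \<Omega>" for x
    proof (cases "q x > 0")
      case True
      then show ?thesis using above[OF that True] flat_pos(2)[of 2 "q x"]
        unfolding grad_u by - (rule mult_nonneg_nonpos, simp_all)
    qed (simp add: grad_u flat_exp_def)
    have "open {y. q y > 0}"
      using q_smooth[of 0] by (intro open_Collect_less) auto
    moreover have "q x0 > 0" using R(1) by (simp add: q_def n2_def s_def power2_eq_square)
    moreover have "x0 \<in> closure \<Omega>" using x0 by (simp add: frontier_def)
    ultimately obtain y where "y \<in> \<Omega>" "q y > 0"
      unfolding closure_iff_nhds_not_empty by blast
    then show "\<exists>x\<in>\<Omega>. grad u x \<bullet> e < 0"
      using above[of y] flat_pos(1)[of 2 "q y"]
      by (intro bexI[of _ y]) (simp_all add: grad_u mult_pos_neg)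
  qed
qed

section \<open>The counterexample\<close>

lemma integral_neg_if_nonpos_continuous:
  fixes f :: "'a::euclidean_space \<Rightarrow> real"
  assumes \<Omega>: "open \<Omega>" "bounded \<Omega>" and f: "continuous_on UNIV f"
    and le: "\<And>x. x \<in> \<Omega> \<Longrightarrow> f x \<le> 0" and neg: "\<exists>x\<in>\<Omega>. f x < 0"
  shows "(LINT x|lebesgue_on \<Omega>. f x) < 0"
proof -
  have m: "\<Omega> \<in> sets lebesgue" using \<Omega> by auto
  have int: "integrable (lebesgue_on \<Omega>) (\<lambda>x. - f x)"
    by (intro integrable_continuous_lebesgue_on_bounded \<Omega> m continuous_intros f)
  have nn: "AE x in lebesgue_on \<Omega>. 0 \<le> - f x"
    using le by (intro AE_I2) (auto simp: space_restrict_space)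
  have "(LINT x|lebesgue_on \<Omega>. - f x) \<noteq> 0"
  proof
    assume "(LINT x|lebesgue_on \<Omega>. - f x) = 0"
    then have "AE x in lebesgue_on \<Omega>. - f x = 0"
      using integral_nonneg_eq_0_iff_AE[OF int nn] by simp
    then have ae: "AE x in lebesgue. x \<in> \<Omega> \<longrightarrow> f x = 0"
      using m by (simp add: AE_restrict_space_iff)
    let ?A = "\<Omega> \<inter> {x. f x < 0}"
    have "open ?A" using \<Omega>(1) f by (intro open_Int open_Collect_less) auto
    moreover have "negligible ?A"
    proof -
      have "AE x in lebesgue. x \<notin> ?A" using ae by eventually_elim auto
      then have "?A \<in> null_sets lebesgue"
        using \<open>open ?A\<close> by (subst AE_iff_null_sets) auto
      then show ?thesis by (simp add: negligible_iff_null_sets)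
    qed
    ultimately show False using neg open_not_negligible[of ?A] by auto
  qed
  moreover have "(LINT x|lebesgue_on \<Omega>. - f x) \<ge> 0" using nn by (rule integral_nonneg_AE)
  ultimately show ?thesis by simp
qed

theorem lemma7p1:
  fixes \<Omega> \<Gamma>\<^sub>D \<Gamma>\<^sub>N :: "(real ^ 'n) set" and T :: "(real ^ 'n) set set" and \<kappa> :: real
  assumes "CARD('n) = 2 \<or> CARD('n) = 3"
    and "bounded \<Omega>" and "open \<Omega>" and "connected \<Omega>" and "lipschitz_boundary \<Omega>"
    and "frontier \<Omega> = closure \<Gamma>\<^sub>D \<union> closure \<Gamma>\<^sub>N" and "\<Gamma>\<^sub>D \<inter> \<Gamma>\<^sub>N = {}"
    and "openin (top_of_set (frontier \<Omega>)) \<Gamma>\<^sub>D" and "openin (top_of_set (frontier \<Omega>)) \<Gamma>\<^sub>N"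
    and "simplicial_mesh \<Omega> T" and "shape_regular \<kappa> T"
    and "boundary_faces \<Omega> T = faces_on \<Omega> T \<Gamma>\<^sub>D \<union> faces_on \<Omega> T \<Gamma>\<^sub>N"
    and "connected \<Gamma>\<^sub>D" and "boundary_area \<Omega> T \<Gamma>\<^sub>D > 0" and "\<Gamma>\<^sub>N \<noteq> {}"
  shows "\<not> (\<exists>C>0. \<forall>\<tau>\<in>Hdiv \<Omega>. \<forall>v\<in>W_space \<Omega> T \<Gamma>\<^sub>D.
           \<forall>div\<tau> gradv. has_weak_div \<Omega> \<tau> div\<tau> \<and> has_broken_grad \<Omega> T v gradv \<longrightarrow>
             C * ((L2_norm \<Omega> gradv)\<^sup>2 + (L2_norm \<Omega> \<tau>)\<^sup>2 + (L2_norm \<Omega> div\<tau>)\<^sup>2)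
             \<le> (L2_norm \<Omega> (\<lambda>x. gradv x + \<tau> x))\<^sup>2 + (L2_norm \<Omega> div\<tau>)\<^sup>2)"
proof
  assume "\<exists>C>0. \<forall>\<tau>\<in>Hdiv \<Omega>. \<forall>v\<in>W_space \<Omega> T \<Gamma>\<^sub>D.
           \<forall>div\<tau> gradv. has_weak_div \<Omega> \<tau> div\<tau> \<and> has_broken_grad \<Omega> T v gradv \<longrightarrow>
             C * ((L2_norm \<Omega> gradv)\<^sup>2 + (L2_norm \<Omega> \<tau>)\<^sup>2 + (L2_norm \<Omega> div\<tau>)\<^sup>2)
             \<le> (L2_norm \<Omega> (\<lambda>x. gradv x + \<tau> x))\<^sup>2 + (L2_norm \<Omega> div\<tau>)\<^sup>2"
  then obtain C where C: "C > 0"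
    and ineq: "\<And>\<tau> v div\<tau> gradv. \<lbrakk>v \<in> W_space \<Omega> T \<Gamma>\<^sub>D; has_weak_div \<Omega> \<tau> div\<tau>; has_broken_grad \<Omega> T v gradv\<rbrakk> \<Longrightarrow>
      C * ((L2_norm \<Omega> gradv)\<^sup>2 + (L2_norm \<Omega> \<tau>)\<^sup>2 + (L2_norm \<Omega> div\<tau>)\<^sup>2)
             \<le> (L2_norm \<Omega> (\<lambda>x. gradv x + \<tau> x))\<^sup>2 + (L2_norm \<Omega> div\<tau>)\<^sup>2"
    by (force simp: Hdiv_def)
  note \<Omega> = \<open>open \<Omega>\<close> \<open>bounded \<Omega>\<close>
  have m: "\<Omega> \<in> sets lebesgue" using \<Omega> by auto
  obtain x0 where x0: "x0 \<in> \<Gamma>\<^sub>N" using \<open>\<Gamma>\<^sub>N \<noteq> {}\<close> by blast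
  obtain U where U: "open U" "\<Gamma>\<^sub>N = frontier \<Omega> \<inter> U"
    using \<open>openin (top_of_set (frontier \<Omega>)) \<Gamma>\<^sub>N\<close> by (auto simp: openin_open)
  obtain \<rho> where \<rho>: "\<rho> > 0" "ball x0 \<rho> \<subseteq> U" using U x0 by (meson IntE openE)
  have "\<Gamma>\<^sub>D \<subseteq> frontier \<Omega>"
    using \<open>openin (top_of_set (frontier \<Omega>)) \<Gamma>\<^sub>D\<close> by (auto simp: openin_open)
  then have \<Gamma>D: "\<Gamma>\<^sub>D \<inter> ball x0 \<rho> = {}" using \<rho>(2) U(2) \<open>\<Gamma>\<^sub>D \<inter> \<Gamma>\<^sub>N = {}\<close> by blast
  obtain u e where u: "u \<in> Cinf" and supp: "{x. u x \<noteq> 0} \<subseteq> ball x0 \<rho>"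
    and le: "\<And>x. x \<in> \<Omega> \<Longrightarrow> grad u x \<bullet> e \<le> 0" and neg: "\<exists>x\<in>\<Omega>. grad u x \<bullet> e < 0"
    using lipschitz_boundary_bump[OF \<open>open \<Omega>\<close> \<open>lipschitz_boundary \<Omega>\<close> _ \<rho>(1)] x0 U(2) by blast
  have u0: "u x = 0" if "x \<in> \<Gamma>\<^sub>D" for x using that supp \<Gamma>D by blast
  let ?V = "grad ` test_functions \<Omega>"
  have gradL: "grad f \<in> L2 \<Omega>" if "f \<in> Cinf" for f
    by (intro continuous_imp_L2 \<Omega> m continuous_on_grad that)
  have zero: "(\<lambda>_. 0) \<in> test_functions \<Omega>"
    by (simp add: test_functions_def Cinf_def Ck_const)
  have V: "?V \<subseteq> L2 \<Omega>" "?V \<noteq> {}"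
    using zero by (auto intro: gradL test_functionsD)
  have V_lin: "(\<lambda>x. w x + t *\<^sub>R z x) \<in> ?V" if "w \<in> ?V" "z \<in> ?V" for w z t
  proof -
    from that obtain \<phi> \<psi> where *: "\<phi> \<in> test_functions \<Omega>" "\<psi> \<in> test_functions \<Omega>"
      "w = grad \<phi>" "z = grad \<psi>"
      by blast
    show ?thesis
    proof (rule image_eqI)
      show "(\<lambda>x. w x + t *\<^sub>R z x) = grad (\<lambda>x. \<phi> x + t * \<psi> x)"
        unfolding *(3,4) by (intro Cinf_add_scale(2)[symmetric] test_functionsD(1)[OF *(1)]
            test_functionsD(1)[OF *(2)])
    qed (rule test_functions_add_scale[OF *(1,2)])
  qed
  have "\<exists>p\<in>L2 \<Omega>. \<exists>w. (\<forall>n::nat. w n \<in> ?V) \<and>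
      (\<lambda>n. L2_norm \<Omega> (\<lambda>x. p x - w n x)) \<longlonglongrightarrow> 0 \<and>
      (\<forall>z\<in>?V. (LINT x|lebesgue_on \<Omega>. (p x - grad u x) \<bullet> z x) = 0)"
    by (rule L2_projection[OF V gradL[OF u]]) (rule V_lin)
  then obtain p w where p: "p \<in> L2 \<Omega>" and w: "\<And>n. w n \<in> ?V"
    and lim: "(\<lambda>n. L2_norm \<Omega> (\<lambda>x. p x - w n x)) \<longlonglongrightarrow> 0"
    and orth: "\<And>z. z \<in> ?V \<Longrightarrow> (LINT x|lebesgue_on \<Omega>. (p x - grad u x) \<bullet> z x) = 0"
    by blast
  define \<tau> where "\<tau> x = p x - grad u x" for x
  \<comment> \<open>Orthogonality to the gradients of test functions is the weak form of \<open>div \<tau> = 0\<close>.\<close>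
  have \<tau>L: "\<tau> \<in> L2 \<Omega>" unfolding \<tau>_def[abs_def] by (rule L2_diff[OF p gradL[OF u]])
  have div: "has_weak_div \<Omega> \<tau> (\<lambda>_. 0)"
    unfolding has_weak_div_def using \<tau>L orth by (auto simp: L2_iff \<tau>_def)
  have "\<forall>n. \<exists>\<phi>. \<phi> \<in> test_functions \<Omega> \<and> w n = grad \<phi>" using w by blast
  then obtain \<phi> where \<phi>: "\<And>n. \<phi> n \<in> test_functions \<Omega>" and w_eq: "\<And>n. w n = grad (\<phi> n)"
    by (auto dest!: choice)
  have bound: "C * (L2_norm \<Omega> \<tau>)\<^sup>2 \<le> (L2_norm \<Omega> (\<lambda>x. p x - w n x))\<^sup>2" for n
  proof -
    define v where "v x = u x + (-1) * \<phi> n x" for x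
    note ph = test_functionsD[OF \<phi>[of n]]
    have v: "v \<in> Cinf" and gv: "grad v = (\<lambda>x. grad u x + (-1) *\<^sub>R w n x)"
      unfolding v_def w_eq using Cinf_add_scale[OF u ph(1), of "-1"] by auto
    have "\<phi> n x = 0" if "x \<in> \<Gamma>\<^sub>D" for x
    proof -
      have "x \<notin> \<Omega>" using that \<open>\<Gamma>\<^sub>D \<subseteq> frontier \<Omega>\<close> \<Omega>(1) by (auto simp: frontier_def interior_open)
      then have "x \<notin> {x. \<phi> n x \<noteq> 0}"
        using ph(3) closure_subset[of "{x. \<phi> n x \<noteq> 0}"] by (meson subsetD)
      then show ?thesis by simp
    qed
    then have "v \<in> H1D \<Omega> T \<Gamma>\<^sub>D"
      using Cinf_in_H1D[OF \<Omega> \<open>simplicial_mesh \<Omega> T\<close> v, of \<Gamma>\<^sub>D] u0 by (simp add: v_def)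
    then have "v \<in> W_space \<Omega> T \<Gamma>\<^sub>D" by (rule subsetD[OF H1D_subset_W_space])
    from ineq[OF this div has_broken_grad_Cinf[OF \<Omega> \<open>simplicial_mesh \<Omega> T\<close> v]]
    have "C * ((L2_norm \<Omega> (grad v))\<^sup>2 + (L2_norm \<Omega> \<tau>)\<^sup>2) \<le> (L2_norm \<Omega> (\<lambda>x. p x - w n x))\<^sup>2"
      by (simp add: gv \<tau>_def L2_norm_def[of \<Omega> "\<lambda>_. 0"])
    moreover have "C * (L2_norm \<Omega> \<tau>)\<^sup>2 \<le> C * ((L2_norm \<Omega> (grad v))\<^sup>2 + (L2_norm \<Omega> \<tau>)\<^sup>2)"
      using C by simp
    ultimately show ?thesis by linarith
  qed
  have "(\<lambda>n. (L2_norm \<Omega> (\<lambda>x. p x - w n x))\<^sup>2) \<longlonglongrightarrow> 0"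
    using tendsto_power[OF lim, of 2] by simp
  then have "C * (L2_norm \<Omega> \<tau>)\<^sup>2 \<le> 0"
    by (rule LIMSEQ_le_const) (use bound in blast)
  then have \<tau>0: "L2_norm \<Omega> \<tau> = 0" using C by (simp add: mult_le_0_iff)
  \<comment> \<open>The constant field \<open>e\<close> detects that \<open>\<tau>\<close> is nonzero.\<close>
  have eL: "(\<lambda>_. e) \<in> L2 \<Omega>" by (intro continuous_imp_L2 \<Omega> m) auto
  have p_lim: "(\<lambda>n. L2_norm \<Omega> (\<lambda>x. p x - w n x) * L2_norm \<Omega> (\<lambda>_. e)) \<longlonglongrightarrow> 0"
    using tendsto_mult[OF lim tendsto_const] by simp
  have p_le: "\<bar>LINT x|lebesgue_on \<Omega>. p x \<bullet> e\<bar> \<le> L2_norm \<Omega> (\<lambda>x. p x - w n x) * L2_norm \<Omega> (\<lambda>_. e)" for n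
  proof -
    have wL: "w n \<in> L2 \<Omega>" unfolding w_eq by (intro gradL test_functionsD[OF \<phi>])
    have "(LINT x|lebesgue_on \<Omega>. (p x - w n x) \<bullet> e) =
        (LINT x|lebesgue_on \<Omega>. p x \<bullet> e) - (LINT x|lebesgue_on \<Omega>. w n x \<bullet> e)"
      using L2_inner_integrable[OF p eL] L2_inner_integrable[OF wL eL]
      by (simp add: inner_diff_left)
    also have "(LINT x|lebesgue_on \<Omega>. w n x \<bullet> e) = 0"
      unfolding w_eq by (rule integral_grad_test_function[OF m \<phi>])
    finally show ?thesis using L2_Cauchy_Schwarz[OF L2_diff[OF p wL] eL] by simp
  qed
  have "\<bar>LINT x|lebesgue_on \<Omega>. p x \<bullet> e\<bar> \<le> 0"
    by (rule LIMSEQ_le_const[OF p_lim]) (use p_le in blast)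
  moreover have "(LINT x|lebesgue_on \<Omega>. \<tau> x \<bullet> e) = 0"
    using L2_Cauchy_Schwarz[OF \<tau>L eL] \<tau>0 by simp
  moreover have "(LINT x|lebesgue_on \<Omega>. \<tau> x \<bullet> e) =
      (LINT x|lebesgue_on \<Omega>. p x \<bullet> e) - (LINT x|lebesgue_on \<Omega>. grad u x \<bullet> e)"
    using L2_inner_integrable[OF p eL] L2_inner_integrable[OF gradL[OF u] eL]
    by (simp add: \<tau>_def inner_diff_left)
  moreover have "(LINT x|lebesgue_on \<Omega>. grad u x \<bullet> e) < 0"
    by (rule integral_neg_if_nonpos_continuous[OF \<Omega> _ le neg])
      (auto intro!: continuous_intros continuous_on_grad u)
  ultimately show False by simp
qed

end
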